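(* Let $p>2$ be a prime, $s\ge 1$ an integer, and let $y$ be a $p$-adic integer with $\nu_p(y)=0$ and $y\neq 1$. Define a $p$-adic number $z$ by \[z\equiv\frac{1}{p^2}\sum_{j=1}^{s-1}\frac{(-1)^{j+1}}{j}\left(y^{p(p-1)}-1\right)^j\pmod{p^s},\] and for $0\le i\le s-1$ define \[A_{i}(s)\equiv \sum_{m=i}^{s-1}(-1)^m p^m\binom{m}{i}\left(\sum_{k=1}^{p-1}\frac{y^{p k}}{k^{m+1}}\right)\left(\sum_{k=0}^{m-i}k!\,\mathfrak{S}_{m-i}^{(k)}\frac{y^{p^2 k}}{\left(1-y^{p^2}\right)^{k+1}}\right)\pmod{p^s},\] \[N_i(s)\equiv-p^{2i+1}\frac{z^{i+1}}{(i+1)!}+\sum_{m=i}^{s-2}p^{2m+1}\frac{ z^{m+1}}{(m+1)!}\binom{m}{i}\left(\sum_{k=0}^{m-i}k!\,\mathfrak{S}_{m-i}^{(k)}\frac{y^{p k}}{\left(1-y^p\right)^{k+1}}\right)\pmod{p^s}.\] Then for every integer $n\ge 1$, \[\sum_{\substack{j=1\\ (j,p)=1}}^{pn}\frac{y^{p j}}{j}\equiv A_{0}(s)-y^{p^2 n}\sum_{i=0}^{s-1} A_i(s)n^{i} \pmod{p^s},\qquad \sum_{j=1}^{n}\frac{y^{p^2 j}-y^{p j}}{p j}\equiv N_0(s)-y^{p n}\sum_{i=0}^{s-1}N_i(s)n^i\pmod{p^s}.\]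
   Context: $\nu_p$ is the $p$-adic valuation, and for $a,b\in\mathbb{Q}_p$, $a\equiv b\pmod{p^s}$ means $\nu_p(a-b)\ge s$. $\mathfrak{S}_{r}^{(k)}$ denotes the Stirling numbers of the second kind (number of partitions of an $r$-element set into $k$ nonempty blocks, with $\mathfrak{S}_0^{(0)}=1$). Empty sums are $0$. These two sums are the two pieces of $G_{pn}(y^p)-G_n(y^p)/p$, where $G_n(y)=\sum_{j=1}^n y^j/j$. *)

theory Defs
  imports
    "Berlekamp_Zassenhaus.Finite_Field"
    "HOL-Library.Extended"
    "HOL-Combinatorics.Stirling"
begin

definition rat_pval :: "nat \<Rightarrow> rat \<Rightarrow> int extended" where
  "rat_pval p q =
     (if q = 0 then Pinf
      else Fin (int (multiplicity (int p) (fst (quotient_of q)))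
                - int (multiplicity (int p) (snd (quotient_of q)))))"

lemma rat_pval_0 [simp]: "rat_pval p 0 = Pinf"
  by (simp add: rat_pval_def)

lemma rat_pval_eq_Pinf_iff [simp]: "rat_pval p q = Pinf \<longleftrightarrow> q = 0"
  by (simp add: rat_pval_def)

lemma rat_pval_cases:
  obtains "q = 0" | v where "q \<noteq> 0" "rat_pval p q = Fin v"
  by (cases "q = 0") (auto simp: rat_pval_def)

lemma rat_fraction:
  fixes q :: rat
  obtains a b where "q = of_int a / of_int b" "b > 0"
proof (cases "quotient_of q")
  case (Pair a b)
  show ?thesis using that[OF quotient_of_div[OF Pair] quotient_of_denom_pos[OF Pair]] .
qed

lemma Fin_le_rat_pval_all_iff: "(\<forall>k. Fin k \<le> rat_pval p q) \<longleftrightarrow> q = 0"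
proof
  assume *: "\<forall>k. Fin k \<le> rat_pval p q"
  show "q = 0"
  proof (cases rule: rat_pval_cases[where q = q and p = p])
    case (2 v)
    then show ?thesis using *[rule_format, of "v + 1"] by simp
  qed
qed auto

context
  fixes p :: nat
  assumes p: "prime p"
begin

lemma rat_pval_divide_int:
  assumes "a \<noteq> 0" "b \<noteq> 0"
  shows "rat_pval p (of_int a / of_int b) =
    Fin (int (multiplicity (int p) a) - int (multiplicity (int p) b))"
proof -
  define q :: rat where "q = of_int a / of_int b"
  obtain c d where cd: "quotient_of q = (c, d)" by (cases "quotient_of q")
  have d: "d > 0" using quotient_of_denom_pos[OF cd] .
  have q: "q = of_int c / of_int d" using quotient_of_div[OF cd] .
  have q0: "q \<noteq> 0" using assms by (simp add: q_def)
  then have c: "c \<noteq> 0" using q by auto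
  have "(of_int (a * d) :: rat) = of_int (c * b)"
    using q d assms by (simp add: q_def field_simps)
  then have e: "a * d = c * b" by (simp only: of_int_eq_iff)
  have pe: "prime_elem (int p)" using p by simp
  have "multiplicity (int p) a + multiplicity (int p) d =
        multiplicity (int p) c + multiplicity (int p) b"
    using e prime_elem_multiplicity_mult_distrib[OF pe, of a d]
      prime_elem_multiplicity_mult_distrib[OF pe, of c b] assms d c by simp
  then have "rat_pval p q = Fin (int (multiplicity (int p) a) - int (multiplicity (int p) b))"
    using q0 cd by (simp add: rat_pval_def)
  then show ?thesis by (simp add: q_def)
qed

lemma rat_pval_mult: "rat_pval p (x * y) = rat_pval p x + rat_pval p y"
proof -
  obtain a b where x: "x = of_int a / of_int b" and b: "b > 0"
    by (rule rat_fraction)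
  obtain c d where y: "y = of_int c / of_int d" and d: "d > 0"
    by (rule rat_fraction)
  have pe: "prime_elem (int p)" using p by simp
  show ?thesis
  proof (cases "x = 0 \<or> y = 0")
    case True
    then show ?thesis
      by (cases rule: rat_pval_cases[where q = x and p = p]; cases rule: rat_pval_cases[where q = y and p = p]) auto
  next
    case False
    then have ac: "a \<noteq> 0" "c \<noteq> 0" using x y by auto
    have "rat_pval p (x * y) = rat_pval p (of_int (a * c) / of_int (b * d))"
      by (simp add: x y)
    also have "\<dots> = rat_pval p x + rat_pval p y"
      unfolding x y using ac b d
      by (simp add: rat_pval_divide_int prime_elem_multiplicity_mult_distrib[OF pe] del: of_int_mult)
    finally show ?thesis .
  qed
qed

lemma rat_pval_minus [simp]: "rat_pval p (- x) = rat_pval p x"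
proof -
  obtain a b where x: "x = of_int a / of_int b" and b: "b > 0"
    by (rule rat_fraction)
  have mm: "multiplicity (int p) (- a) = multiplicity (int p) a"
    by (rule multiplicity_cong) simp
  show ?thesis
  proof (cases "x = 0")
    case False
    then have a: "a \<noteq> 0" using x by auto
    have "rat_pval p (- x) = rat_pval p (of_int (- a) / of_int b)" by (simp add: x)
    also have "\<dots> = rat_pval p x"
      unfolding x using a b
      by (simp add: rat_pval_divide_int mm del: of_int_minus)
    finally show ?thesis .
  qed simp
qed

lemma rat_pval_minus_commute: "rat_pval p (x - y) = rat_pval p (y - x)"
  using rat_pval_minus[of "x - y"] by simp

lemma rat_pval_add: "min (rat_pval p x) (rat_pval p y) \<le> rat_pval p (x + y)"
proof (cases "x = 0 \<or> y = 0 \<or> x + y = 0")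
  case False
  obtain a b where x: "x = of_int a / of_int b" and b: "b > 0"
    by (rule rat_fraction)
  obtain c d where y: "y = of_int c / of_int d" and d: "d > 0"
    by (rule rat_fraction)
  define e f g where "e = a * d" "f = c * b" "g = b * d"
  have x': "x = of_int e / of_int g" and y': "y = of_int f / of_int g"
    using b d by (simp_all add: x y e_f_g_def)
  have xy: "x + y = of_int (e + f) / of_int g"
    by (simp add: x' y' add_divide_distrib)
  have nz: "e \<noteq> 0" "f \<noteq> 0" "g \<noteq> 0" "e + f \<noteq> 0"
    using False x' y' xy by auto
  define m where "m = min (multiplicity (int p) e) (multiplicity (int p) f)"
  have "int p ^ m dvd e" "int p ^ m dvd f"
    by (auto simp: m_def intro!: multiplicity_dvd')
  then have "int p ^ m dvd e + f" by simp
  moreover have "\<not> is_unit (int p)" using prime_gt_1_nat[OF p] by simp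
  ultimately have "m \<le> multiplicity (int p) (e + f)"
    using nz by (intro multiplicity_geI) auto
  then show ?thesis
    unfolding xy unfolding x' y' using nz
    by (simp add: rat_pval_divide_int m_def min_def split: if_splits del: of_int_add)
qed (auto simp: min_def)

lemma rat_pval_add_ge: "k \<le> rat_pval p x \<Longrightarrow> k \<le> rat_pval p y \<Longrightarrow> k \<le> rat_pval p (x + y)"
  using rat_pval_add[of x y] by (meson min.boundedI order_trans)

lemma rat_pval_diff_ge: "k \<le> rat_pval p x \<Longrightarrow> k \<le> rat_pval p y \<Longrightarrow> k \<le> rat_pval p (x - y)"
  using rat_pval_add_ge[of k x "- y"] by simp

lemma rat_pval_1 [simp]: "rat_pval p 1 = 0"
  using rat_pval_divide_int[of 1 1] by (simp add: zero_extended_def)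

lemma rat_pval_inverse: "x \<noteq> 0 \<Longrightarrow> rat_pval p (inverse x) = - rat_pval p x"
proof -
  assume x: "x \<noteq> 0"
  have "rat_pval p x + rat_pval p (inverse x) = 0"
    using rat_pval_mult[of x "inverse x"] x by simp
  then show ?thesis
    using x by (cases rule: rat_pval_cases[where q = x and p = p]; cases rule: rat_pval_cases[where q = "inverse x" and p = p])
      (auto simp: zero_extended_def)
qed

lemma rat_pval_eqI:
  assumes "rat_pval p x = Fin v" "Fin v < rat_pval p (y - x)"
  shows "rat_pval p y = Fin v"
proof (rule antisym)
  show "Fin v \<le> rat_pval p y"
    using rat_pval_add_ge[of "Fin v" x "y - x"] assms by simp
  show "rat_pval p y \<le> Fin v"
  proof (rule ccontr)
    assume n: "\<not> rat_pval p y \<le> Fin v"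
    then have "Fin v < min (rat_pval p y) (rat_pval p (y - x))"
      using assms(2) by simp
    also have "\<dots> \<le> rat_pval p (y - (y - x))"
      by (rule rat_pval_diff_ge) auto
    finally show False using assms(1) by simp
  qed
qed

end

definition pcauchy :: "nat \<Rightarrow> (nat \<Rightarrow> rat) \<Rightarrow> bool" where
  "pcauchy p X \<longleftrightarrow> (\<forall>k. \<exists>N. \<forall>m\<ge>N. \<forall>n\<ge>N. Fin k \<le> rat_pval p (X m - X n))"

definition pvanishes :: "nat \<Rightarrow> (nat \<Rightarrow> rat) \<Rightarrow> bool" where
  "pvanishes p X \<longleftrightarrow> (\<forall>k. \<exists>N. \<forall>n\<ge>N. Fin k \<le> rat_pval p (X n))"

definition padic_rel :: "nat \<Rightarrow> (nat \<Rightarrow> rat) \<Rightarrow> (nat \<Rightarrow> rat) \<Rightarrow> bool" where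
  "padic_rel p X Y \<longleftrightarrow> pcauchy p X \<and> pcauchy p Y \<and> pvanishes p (\<lambda>n. X n - Y n)"

lemma pcauchy_const [simp]: "pcauchy p (\<lambda>_. q)"
  by (simp add: pcauchy_def)

lemma pvanishes_const [simp]: "pvanishes p (\<lambda>_. q) \<longleftrightarrow> q = 0"
  using Fin_le_rat_pval_all_iff[of p q] by (auto simp: pvanishes_def)

context
  fixes p :: nat
  assumes p: "prime p"
begin

lemma pvanishes_minus: "pvanishes p X \<Longrightarrow> pvanishes p (\<lambda>n. - X n)"
  by (simp add: pvanishes_def rat_pval_minus[OF p])

lemma pvanishes_add:
  assumes "pvanishes p X" "pvanishes p Y"
  shows "pvanishes p (\<lambda>n. X n + Y n)"
  unfolding pvanishes_def
proof
  fix k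
  obtain M where M: "\<And>n. n \<ge> M \<Longrightarrow> Fin k \<le> rat_pval p (X n)"
    using assms(1) unfolding pvanishes_def by blast
  obtain N where N: "\<And>n. n \<ge> N \<Longrightarrow> Fin k \<le> rat_pval p (Y n)"
    using assms(2) unfolding pvanishes_def by blast
  show "\<exists>N. \<forall>n\<ge>N. Fin k \<le> rat_pval p (X n + Y n)"
    by (rule exI[of _ "max M N"]) (auto intro!: rat_pval_add_ge[OF p] M N)
qed

lemma pcauchy_minus: "pcauchy p X \<Longrightarrow> pcauchy p (\<lambda>n. - X n)"
  unfolding pcauchy_def using rat_pval_minus_commute[OF p] by simp

lemma pcauchy_add:
  assumes "pcauchy p X" "pcauchy p Y"
  shows "pcauchy p (\<lambda>n. X n + Y n)"
  unfolding pcauchy_def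
proof
  fix k
  obtain M where M: "\<And>m n. m \<ge> M \<Longrightarrow> n \<ge> M \<Longrightarrow> Fin k \<le> rat_pval p (X m - X n)"
    using assms(1) unfolding pcauchy_def by blast
  obtain N where N: "\<And>m n. m \<ge> N \<Longrightarrow> n \<ge> N \<Longrightarrow> Fin k \<le> rat_pval p (Y m - Y n)"
    using assms(2) unfolding pcauchy_def by blast
  have "Fin k \<le> rat_pval p (X m + Y m - (X n + Y n))" if "m \<ge> max M N" "n \<ge> max M N" for m n
    using rat_pval_add_ge[OF p M[of m n] N[of m n]] that by (simp add: algebra_simps)
  then show "\<exists>N. \<forall>m\<ge>N. \<forall>n\<ge>N. Fin k \<le> rat_pval p (X m + Y m - (X n + Y n))" by blast
qed

lemma pcauchy_bounded:
  assumes "pcauchy p X"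
  obtains b N where "\<And>n. n \<ge> N \<Longrightarrow> Fin b \<le> rat_pval p (X n)"
proof -
  obtain N where N: "\<And>m n. m \<ge> N \<Longrightarrow> n \<ge> N \<Longrightarrow> Fin 0 \<le> rat_pval p (X m - X n)"
    using assms unfolding pcauchy_def by blast
  obtain b where b: "b \<le> 0" "Fin b \<le> rat_pval p (X N)"
  proof (cases rule: rat_pval_cases[where q = "X N" and p = p])
    case 1
    then show ?thesis using that[of 0] by simp
  next
    case (2 v)
    then show ?thesis using that[of "min v 0"] by simp
  qed
  show ?thesis
  proof (rule that[of N b])
    fix n assume n: "n \<ge> N"
    have "Fin b \<le> Fin 0" using b by simp
    also have "\<dots> \<le> rat_pval p (X n - X N)" using N n by simp
    finally show "Fin b \<le> rat_pval p (X n)"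
      using rat_pval_add_ge[OF p, of "Fin b" "X n - X N" "X N"] b by simp
  qed
qed

lemma rat_pval_mult_ge:
  "Fin a \<le> rat_pval p x \<Longrightarrow> Fin b \<le> rat_pval p y \<Longrightarrow> Fin (a + b) \<le> rat_pval p (x * y)"
  by (cases rule: rat_pval_cases[where q = x and p = p]; cases rule: rat_pval_cases[where q = y and p = p])
    (auto simp: rat_pval_mult[OF p])

lemma pvanishes_mult_bounded:
  assumes "pcauchy p X" "pvanishes p Y"
  shows "pvanishes p (\<lambda>n. X n * Y n)"
  unfolding pvanishes_def
proof
  fix k
  obtain b M where M: "\<And>n. n \<ge> M \<Longrightarrow> Fin b \<le> rat_pval p (X n)"
    by (rule pcauchy_bounded[OF assms(1)]) (rule that)
  obtain N where N: "\<And>n. n \<ge> N \<Longrightarrow> Fin (k - b) \<le> rat_pval p (Y n)"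
    using assms(2) unfolding pvanishes_def by blast
  have "Fin k \<le> rat_pval p (X n * Y n)" if "n \<ge> max M N" for n
    using rat_pval_mult_ge[OF M[of n] N[of n]] that by simp
  then show "\<exists>N. \<forall>n\<ge>N. Fin k \<le> rat_pval p (X n * Y n)" by blast
qed

lemma pcauchy_mult:
  assumes "pcauchy p X" "pcauchy p Y"
  shows "pcauchy p (\<lambda>n. X n * Y n)"
  unfolding pcauchy_def
proof
  fix k
  obtain a K where K: "\<And>n. n \<ge> K \<Longrightarrow> Fin a \<le> rat_pval p (X n)"
    by (rule pcauchy_bounded[OF assms(1)]) (rule that)
  obtain b L where L: "\<And>n. n \<ge> L \<Longrightarrow> Fin b \<le> rat_pval p (Y n)"
    by (rule pcauchy_bounded[OF assms(2)]) (rule that)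
  obtain M where M: "\<And>m n. m \<ge> M \<Longrightarrow> n \<ge> M \<Longrightarrow> Fin (k - b) \<le> rat_pval p (X m - X n)"
    using assms(1) unfolding pcauchy_def by blast
  obtain N where N: "\<And>m n. m \<ge> N \<Longrightarrow> n \<ge> N \<Longrightarrow> Fin (k - a) \<le> rat_pval p (Y m - Y n)"
    using assms(2) unfolding pcauchy_def by blast
  have "Fin k \<le> rat_pval p (X m * Y m - X n * Y n)"
    if "m \<ge> max (max K L) (max M N)" "n \<ge> max (max K L) (max M N)" for m n
  proof -
    have "Fin k \<le> rat_pval p (X m * (Y m - Y n))"
      using rat_pval_mult_ge[OF K[of m] N[of m n]] that by simp
    moreover have "Fin k \<le> rat_pval p ((X m - X n) * Y n)"
      using rat_pval_mult_ge[OF M[of m n] L[of n]] that by simp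
    ultimately show ?thesis
      using rat_pval_add_ge[OF p, of "Fin k" "X m * (Y m - Y n)" "(X m - X n) * Y n"]
      by (simp add: algebra_simps)
  qed
  then show "\<exists>N. \<forall>m\<ge>N. \<forall>n\<ge>N. Fin k \<le> rat_pval p (X m * Y m - X n * Y n)" by blast
qed

lemma pcauchy_not_pvanishes:
  assumes "pcauchy p X" "\<not> pvanishes p X"
  obtains v N where "\<And>n. n \<ge> N \<Longrightarrow> rat_pval p (X n) = Fin v"
proof -
  obtain k where k: "\<And>N. \<exists>n\<ge>N. \<not> Fin k \<le> rat_pval p (X n)"
    using assms(2) unfolding pvanishes_def by blast
  obtain N where N: "\<And>m n. m \<ge> N \<Longrightarrow> n \<ge> N \<Longrightarrow> Fin k \<le> rat_pval p (X m - X n)"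
    using assms(1) unfolding pcauchy_def by blast
  obtain n0 where n0: "n0 \<ge> N" "\<not> Fin k \<le> rat_pval p (X n0)" using k by blast
  then obtain v where v: "rat_pval p (X n0) = Fin v" "v < k"
    by (cases rule: rat_pval_cases[where q = "X n0" and p = p]) auto
  show ?thesis
  proof (rule that[of N v])
    fix n assume n: "n \<ge> N"
    have "Fin v < Fin k" using v by simp
    also have "\<dots> \<le> rat_pval p (X n - X n0)" using N n n0 by simp
    finally show "rat_pval p (X n) = Fin v" by (rule rat_pval_eqI[OF p v(1)])
  qed
qed

lemma rat_pval_inverse_diff:
  assumes "rat_pval p x = Fin v" "rat_pval p y = Fin w" "Fin (k + v + w) \<le> rat_pval p (x - y)"
  shows "Fin k \<le> rat_pval p (inverse x - inverse y)"
proof -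
  have nz: "x \<noteq> 0" "y \<noteq> 0" using assms by auto
  then have "inverse x - inverse y = (- inverse x * inverse y) * (x - y)"
    by (simp add: field_simps)
  moreover have "Fin (- v - w) \<le> rat_pval p (- inverse x * inverse y)"
    using assms nz by (simp add: rat_pval_mult[OF p] rat_pval_inverse[OF p] rat_pval_minus[OF p])
  ultimately show ?thesis
    using rat_pval_mult_ge[of "- v - w" "- inverse x * inverse y" "k + v + w" "x - y"] assms(3) by simp
qed

lemma pcauchy_inverse:
  assumes "pcauchy p X" "\<not> pvanishes p X"
  shows "pcauchy p (\<lambda>n. inverse (X n))"
  unfolding pcauchy_def
proof
  fix k
  obtain v M where M: "\<And>n. n \<ge> M \<Longrightarrow> rat_pval p (X n) = Fin v"
    by (rule pcauchy_not_pvanishes[OF assms]) (rule that)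
  obtain N where N: "\<And>m n. m \<ge> N \<Longrightarrow> n \<ge> N \<Longrightarrow> Fin (k + v + v) \<le> rat_pval p (X m - X n)"
    using assms(1) unfolding pcauchy_def by blast
  have "Fin k \<le> rat_pval p (inverse (X m) - inverse (X n))" if "m \<ge> max M N" "n \<ge> max M N" for m n
    using rat_pval_inverse_diff[OF M M N, of m n] that by simp
  then show "\<exists>N. \<forall>m\<ge>N. \<forall>n\<ge>N. Fin k \<le> rat_pval p (inverse (X m) - inverse (X n))" by blast
qed

lemma pvanishes_diff_inverse:
  assumes X: "pcauchy p X" "\<not> pvanishes p X" and Y: "pcauchy p Y" "\<not> pvanishes p Y"
    and XY: "pvanishes p (\<lambda>n. X n - Y n)"
  shows "pvanishes p (\<lambda>n. inverse (X n) - inverse (Y n))"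
  unfolding pvanishes_def
proof
  fix k
  obtain v K where K: "\<And>n. n \<ge> K \<Longrightarrow> rat_pval p (X n) = Fin v"
    by (rule pcauchy_not_pvanishes[OF X]) (rule that)
  obtain w M where M: "\<And>n. n \<ge> M \<Longrightarrow> rat_pval p (Y n) = Fin w"
    by (rule pcauchy_not_pvanishes[OF Y]) (rule that)
  obtain N where N: "\<And>n. n \<ge> N \<Longrightarrow> Fin (k + v + w) \<le> rat_pval p (X n - Y n)"
    using XY unfolding pvanishes_def by blast
  have "Fin k \<le> rat_pval p (inverse (X n) - inverse (Y n))" if "n \<ge> max K (max M N)" for n
    using rat_pval_inverse_diff[OF K M N, of n] that by simp
  then show "\<exists>N. \<forall>n\<ge>N. Fin k \<le> rat_pval p (inverse (X n) - inverse (Y n))" by blast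
qed

lemma pvanishes_inverse_mult:
  assumes "pcauchy p X" "\<not> pvanishes p X"
  shows "pvanishes p (\<lambda>n. inverse (X n) * X n - 1)"
proof -
  obtain v N where N: "\<And>n. n \<ge> N \<Longrightarrow> rat_pval p (X n) = Fin v"
    by (rule pcauchy_not_pvanishes[OF assms]) (rule that)
  have "X n \<noteq> 0" if "n \<ge> N" for n using N[OF that] by auto
  then show ?thesis unfolding pvanishes_def by (intro allI exI[of _ N]) simp
qed

lemma padic_rel_pvanishes_iff:
  assumes "padic_rel p X Y"
  shows "pvanishes p X \<longleftrightarrow> pvanishes p Y"
proof
  have v: "pvanishes p (\<lambda>n. X n - Y n)" using assms by (simp add: padic_rel_def)
  show "pvanishes p X" if "pvanishes p Y" using pvanishes_add[OF v that] by simp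
  show "pvanishes p Y" if "pvanishes p X" using pvanishes_add[OF that pvanishes_minus[OF v]] by simp
qed

lemma part_equivp_padic_rel: "part_equivp (padic_rel p)"
proof (rule part_equivpI)
  show "\<exists>X. padic_rel p X X" by (rule exI[of _ "\<lambda>_. 0"]) (simp add: padic_rel_def)
  show "symp (padic_rel p)"
  proof (rule sympI)
    fix X Y assume "padic_rel p X Y"
    then show "padic_rel p Y X"
      using pvanishes_minus[of "\<lambda>n. X n - Y n"] by (simp add: padic_rel_def)
  qed
  show "transp (padic_rel p)"
  proof (rule transpI)
    fix X Y Z assume "padic_rel p X Y" "padic_rel p Y Z"
    then show "padic_rel p X Z"
      using pvanishes_add[of "\<lambda>n. X n - Y n" "\<lambda>n. Y n - Z n"] by (simp add: padic_rel_def)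
  qed
qed

lemma padic_rel_eventual_pval:
  assumes "padic_rel p X Y" "\<not> pvanishes p X"
  shows "(\<forall>\<^sub>F n in sequentially. rat_pval p (X n) = v) \<longleftrightarrow> (\<forall>\<^sub>F n in sequentially. rat_pval p (Y n) = v)"
proof -
  have X: "pcauchy p X" and Y: "pcauchy p Y" and XY: "pvanishes p (\<lambda>n. X n - Y n)"
    using assms by (simp_all add: padic_rel_def)
  have nY: "\<not> pvanishes p Y" using padic_rel_pvanishes_iff[OF assms(1)] assms(2) by simp
  obtain w M where M: "\<And>n. n \<ge> M \<Longrightarrow> rat_pval p (Y n) = Fin w"
    by (rule pcauchy_not_pvanishes[OF Y nY]) (rule that)
  obtain N where N: "\<And>n. n \<ge> N \<Longrightarrow> Fin (w + 1) \<le> rat_pval p (X n - Y n)"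
    using XY unfolding pvanishes_def by blast
  have ev: "\<forall>\<^sub>F n in sequentially. rat_pval p (X n) = rat_pval p (Y n)"
    unfolding eventually_sequentially
  proof (intro exI allI impI)
    fix n assume n: "max M N \<le> n"
    have "Fin w < Fin (w + 1)" by simp
    also have "\<dots> \<le> rat_pval p (X n - Y n)" using N n by simp
    finally have "rat_pval p (X n) = Fin w"
      using rat_pval_eqI[OF p] M[of n] n by (meson max.boundedE)
    then show "rat_pval p (X n) = rat_pval p (Y n)" using M[of n] n by simp
  qed
  show ?thesis by (rule eventually_subst) (use ev in eventually_elim, simp)
qed

end

text \<open>
  The prime is carried by the type argument: \<open>'a padic\<close> is the completion of the rationals
  with respect to the p-adic valuation for p = \<open>CARD('a)\<close>.
\<close>

typedef (overloaded) 'a padic =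
    "{C. \<exists>X. pcauchy CARD('a::prime_card) X \<and> C = {Y. padic_rel CARD('a) X Y}}"
  by (auto intro: pcauchy_const)

definition Padic :: "(nat \<Rightarrow> rat) \<Rightarrow> 'a::prime_card padic" where
  "Padic X = Abs_padic {Y. padic_rel CARD('a) X Y}"

definition rep_padic :: "'a::prime_card padic \<Rightarrow> nat \<Rightarrow> rat" where
  "rep_padic x = (SOME X. X \<in> Rep_padic x)"

definition cr_padic :: "(nat \<Rightarrow> rat) \<Rightarrow> 'a::prime_card padic \<Rightarrow> bool" where
  "cr_padic X x \<longleftrightarrow> padic_rel CARD('a) X X \<and> Padic X = x"

lemma Padic_eq_iff:
  assumes "pcauchy CARD('a) X" "pcauchy CARD('a) Y"
  shows "(Padic X :: 'a::prime_card padic) = Padic Y \<longleftrightarrow> padic_rel CARD('a) X Y"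
proof -
  have e: "part_equivp (padic_rel CARD('a))" by (rule part_equivp_padic_rel) (rule prime_card)
  have "(Padic X :: 'a padic) = Padic Y \<longleftrightarrow> {Z. padic_rel CARD('a) X Z} = {Z. padic_rel CARD('a) Y Z}"
    unfolding Padic_def using assms by (intro Abs_padic_inject) auto
  also have "\<dots> \<longleftrightarrow> padic_rel CARD('a) X Y"
  proof
    assume "{Z. padic_rel CARD('a) X Z} = {Z. padic_rel CARD('a) Y Z}"
    moreover have "padic_rel CARD('a) Y Y" using assms by (simp add: padic_rel_def)
    ultimately show "padic_rel CARD('a) X Y" by blast
  next
    assume "padic_rel CARD('a) X Y"
    then show "{Z. padic_rel CARD('a) X Z} = {Z. padic_rel CARD('a) Y Z}"
      using part_equivp_symp[OF e] part_equivp_transp[OF e] by blast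
  qed
  finally show ?thesis .
qed

lemma rep_padic: "pcauchy CARD('a) (rep_padic x)" "Padic (rep_padic x) = (x :: 'a::prime_card padic)"
proof -
  obtain X where X: "pcauchy CARD('a) X" "Rep_padic x = {Y. padic_rel CARD('a) X Y}"
    using Rep_padic[of x] by blast
  have "X \<in> Rep_padic x" using X by (simp add: padic_rel_def)
  then have "rep_padic x \<in> Rep_padic x" unfolding rep_padic_def by (auto simp: some_in_eq)
  then have r: "padic_rel CARD('a) X (rep_padic x)" using X by simp
  then show c: "pcauchy CARD('a) (rep_padic x)" by (simp add: padic_rel_def)
  have "x = Padic X" unfolding Padic_def by (simp add: X(2)[symmetric] Rep_padic_inverse)
  then show "Padic (rep_padic x) = x" using Padic_eq_iff[OF X(1) c] r by simp
qed

lemma Quotient_padic: "Quotient (padic_rel CARD('a::prime_card)) Padic rep_padic (cr_padic :: _ \<Rightarrow> 'a padic \<Rightarrow> bool)"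
proof (rule QuotientI)
  fix x :: "'a padic"
  show "Padic (rep_padic x) = x" by (rule rep_padic)
  show "padic_rel CARD('a) (rep_padic x) (rep_padic x)"
    using rep_padic[of x] by (simp add: padic_rel_def)
next
  fix X Y :: "nat \<Rightarrow> rat"
  show "padic_rel CARD('a) X Y \<longleftrightarrow>
    padic_rel CARD('a) X X \<and> padic_rel CARD('a) Y Y \<and> (Padic X :: 'a padic) = Padic Y"
    using Padic_eq_iff[where 'a = 'a, of X Y] by (auto simp: padic_rel_def)
qed (auto simp: cr_padic_def fun_eq_iff)

setup_lifting Quotient_padic

instantiation padic :: (prime_card) field
begin

lift_definition zero_padic :: "'a padic" is "\<lambda>_. 0"
  by (simp add: padic_rel_def)

lift_definition one_padic :: "'a padic" is "\<lambda>_. 1"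
  by (simp add: padic_rel_def)

lift_definition plus_padic :: "'a padic \<Rightarrow> 'a padic \<Rightarrow> 'a padic" is "\<lambda>X Y n. X n + Y n"
  by (simp add: padic_rel_def add_diff_add pcauchy_add pvanishes_add prime_card)

lift_definition uminus_padic :: "'a padic \<Rightarrow> 'a padic" is "\<lambda>X n. - X n"
  unfolding padic_rel_def minus_diff_minus
  by (simp only: pcauchy_minus pvanishes_minus prime_card simp_thms)

lift_definition times_padic :: "'a padic \<Rightarrow> 'a padic \<Rightarrow> 'a padic" is "\<lambda>X Y n. X n * Y n"
proof -
  fix X X' Y Y' :: "nat \<Rightarrow> rat"
  let ?p = "CARD('a)"
  assume XX: "padic_rel ?p X X'" and YY: "padic_rel ?p Y Y'"
  have "pvanishes ?p (\<lambda>n. X n * (Y n - Y' n) + Y' n * (X n - X' n))"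
    using XX YY unfolding padic_rel_def
    by (intro pvanishes_add pvanishes_mult_bounded prime_card) auto
  then have "pvanishes ?p (\<lambda>n. X n * Y n - X' n * Y' n)"
    by (simp add: algebra_simps)
  then show "padic_rel ?p (\<lambda>n. X n * Y n) (\<lambda>n. X' n * Y' n)"
    using XX YY by (simp add: padic_rel_def pcauchy_mult prime_card)
qed

lift_definition inverse_padic :: "'a padic \<Rightarrow> 'a padic"
  is "\<lambda>X. if pvanishes CARD('a) X then (\<lambda>_. 0) else (\<lambda>n. inverse (X n))"
proof -
  fix X Y :: "nat \<Rightarrow> rat"
  assume XY: "padic_rel CARD('a) X Y"
  show "padic_rel CARD('a) (if pvanishes CARD('a) X then (\<lambda>_. 0) else (\<lambda>n. inverse (X n)))
          (if pvanishes CARD('a) Y then (\<lambda>_. 0) else (\<lambda>n. inverse (Y n)))"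
    using padic_rel_pvanishes_iff[OF prime_card XY] XY
    by (auto simp: padic_rel_def pcauchy_inverse pvanishes_diff_inverse prime_card)
qed

definition "x - y = x + - y" for x y :: "'a padic"

definition "x div y = x * inverse y" for x y :: "'a padic"

instance
proof
  fix a b c :: "'a padic"
  show "a + b = b + a"
    by transfer (simp add: padic_rel_def pcauchy_add prime_card add.commute)
  show "(a + b) + c = a + (b + c)"
    by transfer (simp add: padic_rel_def pcauchy_add prime_card add.assoc)
  show "0 + a = a"
    by transfer (simp add: padic_rel_def)
  show "- a + a = 0"
    by transfer (simp add: padic_rel_def)
  show "a - b = a + - b"
    by (rule minus_padic_def)
  show "(a * b) * c = a * (b * c)"
    by transfer (simp add: padic_rel_def pcauchy_mult prime_card mult.assoc)
  show "a * b = b * a"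
    by transfer (simp add: padic_rel_def pcauchy_mult prime_card mult.commute)
  show "1 * a = a"
    by transfer (simp add: padic_rel_def)
  show "(a + b) * c = a * c + b * c"
    by transfer (simp add: padic_rel_def pcauchy_mult pcauchy_add prime_card distrib_right)
  show "(0::'a padic) \<noteq> 1"
    by transfer (simp add: padic_rel_def)
  show "a \<noteq> 0 \<Longrightarrow> inverse a * a = 1"
    by transfer (auto simp: padic_rel_def pvanishes_inverse_mult pcauchy_mult pcauchy_inverse prime_card)
  show "a div b = a * inverse b"
    by (rule divide_padic_def)
  show "inverse (0::'a padic) = 0"
    by transfer (simp add: padic_rel_def)
qed

end

lemma of_nat_padic: "(of_nat k :: 'p::prime_card padic) = Padic (\<lambda>_. of_nat k)"
proof (induction k)
  case 0
  show ?case by (simp add: zero_padic_def)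
next
  case (Suc k)
  show ?case unfolding of_nat_Suc Suc.IH one_padic_def
    by (subst plus_padic.abs_eq) (auto simp: padic_rel_def)
qed

instance padic :: (prime_card) field_char_0
proof
  show "inj (of_nat :: nat \<Rightarrow> 'a padic)"
  proof (rule injI)
    fix j k :: nat
    assume "(of_nat j :: 'a padic) = of_nat k"
    then have "padic_rel CARD('a) (\<lambda>_. of_nat j) (\<lambda>_. of_nat k)"
      unfolding of_nat_padic by (subst (asm) Padic_eq_iff) auto
    then show "j = k" by (simp add: padic_rel_def)
  qed
qed

text \<open>
  On a Cauchy sequence that is not null, the valuation of the terms is eventually constant.
\<close>

lift_definition pval :: "'p::prime_card padic \<Rightarrow> int extended" is
  "\<lambda>X. if pvanishes CARD('p) X then Pinf
       else (THE v. \<forall>\<^sub>F n in sequentially. rat_pval CARD('p) (X n) = v)"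
  by (auto simp: padic_rel_pvanishes_iff[OF prime_card] padic_rel_eventual_pval[OF prime_card])

definition padic_ints :: "'p::prime_card padic set" where
  "padic_ints = {x. 0 \<le> pval x}"

text \<open>Congruence of \<open>a\<close> and \<open>b\<close> modulo the \<open>s\<close>-th power of the prime \<open>CARD('p)\<close>:\<close>

definition padic_cong :: "nat \<Rightarrow> 'p::prime_card padic \<Rightarrow> 'p padic \<Rightarrow> bool" where
  "padic_cong s a b \<longleftrightarrow> Fin (int s) \<le> pval (a - b)"

lemma of_int_padic: "(of_int k :: 'p::prime_card padic) = Padic (\<lambda>_. of_int k)"
proof (cases k rule: int_cases2)
  case (nonneg n)
  then show ?thesis by (simp add: of_nat_padic)
next
  case (nonpos n)
  have "- Padic (\<lambda>_. of_nat n) = (Padic (\<lambda>_. - of_nat n) :: 'p padic)"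
    by (subst uminus_padic.abs_eq) (auto simp: padic_rel_def)
  then show ?thesis using nonpos by (simp add: of_nat_padic)
qed

lemma of_rat_padic: "(of_rat q :: 'p::prime_card padic) = Padic (\<lambda>_. q)"
proof -
  obtain a b where q: "q = of_int a / of_int b" and b: "b > 0"
    by (rule rat_fraction)
  have "Padic (\<lambda>_. q) * of_int b = (of_int a :: 'p padic)"
    unfolding of_int_padic
    by (subst times_padic.abs_eq) (use b in \<open>auto simp: padic_rel_def q\<close>)
  then have "(Padic (\<lambda>_. q) :: 'p padic) = of_int a / of_int b"
    using b by (simp add: field_simps)
  then show ?thesis by (simp add: q of_rat_divide)
qed

lemma pval_Padic:
  assumes "pcauchy CARD('p) X" "\<forall>\<^sub>F n in sequentially. rat_pval CARD('p) (X n) = Fin v"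
  shows "pval (Padic X :: 'p::prime_card padic) = Fin v"
proof -
  let ?p = "CARD('p)"
  obtain N where N: "\<And>n. n \<ge> N \<Longrightarrow> rat_pval ?p (X n) = Fin v"
    using assms(2) by (auto simp: eventually_sequentially)
  have "\<not> pvanishes ?p X"
  proof
    assume "pvanishes ?p X"
    then obtain M where M: "\<And>n. n \<ge> M \<Longrightarrow> Fin (v + 1) \<le> rat_pval ?p (X n)"
      unfolding pvanishes_def by blast
    then show False using M[of "max M N"] N[of "max M N"] by simp
  qed
  moreover have "(THE w. \<forall>\<^sub>F n in sequentially. rat_pval ?p (X n) = w) = Fin v"
  proof (rule the_equality)
    fix w assume "\<forall>\<^sub>F n in sequentially. rat_pval ?p (X n) = w"
    then have "\<forall>\<^sub>F n in sequentially. w = Fin v"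
      using assms(2) by eventually_elim simp
    then show "w = Fin v" by simp
  qed (rule assms(2))
  ultimately show ?thesis
    using assms(1) by (subst pval.abs_eq) (auto simp: padic_rel_def)
qed

lemma padic_cases:
  fixes x :: "'p::prime_card padic"
  obtains "x = 0" "pval x = Pinf"
  | X v where "x \<noteq> 0" "x = Padic X" "pcauchy CARD('p) X" "pval x = Fin v"
      "\<forall>\<^sub>F n in sequentially. rat_pval CARD('p) (X n) = Fin v"
proof -
  have "(x = 0 \<and> pval x = Pinf) \<or> (\<exists>X v. x \<noteq> 0 \<and> x = Padic X \<and> pcauchy CARD('p) X \<and>
      pval x = Fin v \<and> (\<forall>\<^sub>F n in sequentially. rat_pval CARD('p) (X n) = Fin v))"
  proof (induction x rule: padic.abs_induct)
    fix X :: "nat \<Rightarrow> rat"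
    assume XX: "padic_rel CARD('p) X X"
    then have X: "pcauchy CARD('p) X" by (simp add: padic_rel_def)
    have 0: "(Padic X :: 'p padic) = 0 \<longleftrightarrow> pvanishes CARD('p) X"
      unfolding zero_padic_def using X
      by (subst Padic_eq_iff) (auto simp: padic_rel_def)
    show "((Padic X :: 'p padic) = 0 \<and> pval (Padic X :: 'p padic) = Pinf) \<or>
      (\<exists>Y v. (Padic X :: 'p padic) \<noteq> 0 \<and> (Padic X :: 'p padic) = Padic Y \<and> pcauchy CARD('p) Y \<and>
      pval (Padic X :: 'p padic) = Fin v \<and> (\<forall>\<^sub>F n in sequentially. rat_pval CARD('p) (Y n) = Fin v))"
    proof (cases "pvanishes CARD('p) X")
      case True
      then have "pval (Padic X :: 'p padic) = Pinf" by (simp add: pval.abs_eq[OF XX])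
      moreover have "(Padic X :: 'p padic) = 0" using 0 True by (rule iffD2)
      ultimately show ?thesis by (intro disjI1 conjI)
    next
      case False
      obtain v N where N: "\<And>n. n \<ge> N \<Longrightarrow> rat_pval CARD('p) (X n) = Fin v"
        by (rule pcauchy_not_pvanishes[OF prime_card X False]) (rule that)
      then have ev: "\<forall>\<^sub>F n in sequentially. rat_pval CARD('p) (X n) = Fin v"
        by (auto simp: eventually_sequentially)
      have "(Padic X :: 'p padic) \<noteq> 0" using 0 False by simp
      then show ?thesis using X ev pval_Padic[OF X ev]
        by (intro disjI2 exI[of _ X] exI[of _ v] conjI refl)
    qed
  qed
  then show ?thesis
    by (elim disjE exE conjE) (rule that; assumption)+
qed

lemma pval_0 [simp]: "pval 0 = Pinf"
  by (cases rule: padic_cases[where x = 0]) auto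

lemma pval_eq_Pinf_iff [simp]: "pval x = Pinf \<longleftrightarrow> x = 0"
  by (cases rule: padic_cases[where x = x]) auto

lemma pval_of_rat: "pval (of_rat q :: 'p::prime_card padic) = rat_pval CARD('p) q"
proof (cases rule: rat_pval_cases[where q = q and p = "CARD('p)"])
  case (2 v)
  then show ?thesis
    using pval_Padic[where 'p = 'p, of "\<lambda>_. q" v] by (simp add: of_rat_padic)
qed simp

lemma pval_prime [simp]: "pval (of_nat CARD('p) :: 'p::prime_card padic) = Fin 1"
proof -
  have "rat_pval CARD('p) (of_int (int CARD('p)) / of_int 1) = Fin 1"
    by (subst rat_pval_divide_int) (simp_all add: prime_card)
  then show ?thesis using pval_of_rat[where 'p = 'p, of "of_nat CARD('p)"] by simp
qed

lemma pval_mult: "pval (x * y) = pval x + pval (y :: 'p::prime_card padic)"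
proof (cases rule: padic_cases[where x = x])
  case 1
  then show ?thesis by (cases rule: padic_cases[where x = y]) auto
next
  case x: (2 X v)
  show ?thesis
  proof (cases rule: padic_cases[where x = y])
    case 1
    then show ?thesis using x by auto
  next
    case y: (2 Y w)
    have "x * y = Padic (\<lambda>n. X n * Y n)"
      using x y by (simp add: times_padic.abs_eq padic_rel_def)
    moreover have "\<forall>\<^sub>F n in sequentially. rat_pval CARD('p) (X n * Y n) = Fin (v + w)"
      using x(5) y(5) by eventually_elim (simp add: rat_pval_mult prime_card)
    ultimately show ?thesis
      using pval_Padic[where 'p = 'p, of "\<lambda>n. X n * Y n"] x y by (simp add: pcauchy_mult prime_card)
  qed
qed

lemma pval_add: "min (pval x) (pval y) \<le> pval (x + y :: 'p::prime_card padic)"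
proof (cases rule: padic_cases[where x = x])
  case x: (2 X v)
  show ?thesis
  proof (cases rule: padic_cases[where x = y])
    case y: (2 Y w)
    have s: "x + y = Padic (\<lambda>n. X n + Y n)"
      using x y by (simp add: plus_padic.abs_eq padic_rel_def)
    have c: "pcauchy CARD('p) (\<lambda>n. X n + Y n)"
      using x y by (simp add: pcauchy_add prime_card)
    show ?thesis
    proof (cases "pvanishes CARD('p) (\<lambda>n. X n + Y n)")
      case True
      then show ?thesis using c by (simp add: s pval.abs_eq padic_rel_def)
    next
      case False
      obtain u N where "\<And>n. n \<ge> N \<Longrightarrow> rat_pval CARD('p) (X n + Y n) = Fin u"
        by (rule pcauchy_not_pvanishes[OF prime_card c False]) (rule that)
      then have u: "\<forall>\<^sub>F n in sequentially. rat_pval CARD('p) (X n + Y n) = Fin u"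
        by (auto simp: eventually_sequentially)
      have "\<forall>\<^sub>F n in sequentially. min (Fin v) (Fin w) \<le> Fin u"
        using x(5) y(5) u by eventually_elim (metis rat_pval_add[OF prime_card])
      then show ?thesis using x(4) y(4) pval_Padic[OF c u] by (simp add: s)
    qed
  qed simp
qed simp

end

theory Submission
  imports
    Defs
    "HOL-Computational_Algebra.Polynomial_FPS"
    "HOL-Number_Theory.Residues"
begin

text \<open>
  Both sums reduce to the power sums \<open>\<Sum>l<n. l ^ m * x ^ l\<close>, which have an exact closed form whenever
  \<open>x \<noteq> 1\<close>; this is the only place where the Stirling numbers enter, so a small \<open>1 - x\<close> does no harm.
  In the first sum, write \<open>j = k + p l\<close> with \<open>0 < k < p\<close> and expand \<open>1 / (k + p l)\<close> as a geometric
  series in \<open>p\<close>. In the second, \<open>y ^ (p\<^sup>2 j) = y ^ (p j) * (1 + w) ^ j\<close> with \<open>w\<close> divisible by \<open>p\<^sup>2\<close>, and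
  \<open>(1 + w) ^ j = exp (j log (1 + w))\<close> with \<open>log (1 + w) = p\<^sup>2 z\<close> up to truncation. No convergence is
  needed: the truncations of both sides are polynomials in \<open>w\<close> that agree below degree \<open>s\<close>, and after
  division by \<open>p\<close> and the substitution \<open>w = p v\<close> their coefficients are integral, because \<open>n!\<close> divides
  \<open>p ^ (n - 1)\<close> in the \<open>p\<close>-adic integers.
\<close>

unbundle fps_syntax

section \<open>Power sums against a geometric sequence\<close>

text \<open>\<open>(exp T - 1)^k / k!\<close> is the exponential generating function of the Stirling
  numbers: \<open>h = exp T - 1\<close> has derivative \<open>h + 1\<close>, so differentiating
  \<open>h^(l+1)\<close> reproduces their recurrence.\<close>

lemma fps_exp_minus_1_power_nth:
  "fact m * ((fps_exp 1 - 1 :: 'a::field_char_0 fps) ^ k $ m) = fact k * of_nat (Stirling m k)"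
proof (induction m arbitrary: k)
  case 0
  show ?case by (cases k) simp_all
next
  case (Suc m)
  define h where "h = (fps_exp 1 - 1 :: 'a fps)"
  show ?case
  proof (cases k)
    case (Suc l)
    have "fps_deriv (h ^ Suc l) = fps_const (of_nat (Suc l)) * (h ^ Suc l + h ^ l)"
      unfolding fps_deriv_power by (simp add: h_def algebra_simps)
    then have "fps_deriv (h ^ Suc l) $ m = (fps_const (of_nat (Suc l)) * (h ^ Suc l + h ^ l)) $ m"
      by simp
    then have d: "of_nat (Suc m) * (h ^ Suc l $ Suc m) = of_nat (Suc l) * (h ^ Suc l $ m + h ^ l $ m)"
      by (simp del: power_Suc of_nat_Suc)
    have "fact (Suc m) * (h ^ Suc l $ Suc m) = fact m * (of_nat (Suc m) * (h ^ Suc l $ Suc m))"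
      by (simp add: algebra_simps)
    also have "\<dots> = of_nat (Suc l) * (fact m * (h ^ Suc l $ m) + fact m * (h ^ l $ m))"
      unfolding d by (simp add: algebra_simps)
    also have "\<dots> = of_nat (Suc l) * (fact (Suc l) * of_nat (Stirling m (Suc l)) + fact l * of_nat (Stirling m l))"
      using Suc.IH[of "Suc l"] Suc.IH[of l] unfolding h_def by (simp only:)
    also have "\<dots> = fact (Suc l) * of_nat (Stirling (Suc m) (Suc l))"
      by (simp add: algebra_simps)
    finally show ?thesis by (simp add: Suc h_def)
  qed simp
qed

text \<open>For a formal variable \<open>x\<close> this is \<open>\<Sum>l\<ge>0. l ^ m * x ^ l\<close>, whose exponential generating function
  in \<open>m\<close> is \<open>1 / (1 - x * exp T)\<close>.\<close>

definition geom_moment :: "'a::field_char_0 \<Rightarrow> nat \<Rightarrow> 'a" where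
  "geom_moment x m =
     (\<Sum>k=0..m. fact k * of_nat (Stirling m k) * (x ^ k / (1 - x) ^ (k + 1)))"

text \<open>\<open>1 - x exp T = (1 - x) (1 - c)\<close> with
  \<open>c = x / (1 - x) * (exp T - 1)\<close>. As \<open>c\<close> has no constant term, the
  inverse is a geometric series in \<open>c\<close>, and the Stirling numbers give its
  coefficients.\<close>

lemma geom_moment_egf:
  fixes x :: "'a::field_char_0"
  assumes "x \<noteq> 1"
  shows "(1 - fps_const x * fps_exp 1) * Abs_fps (\<lambda>m. geom_moment x m / fact m) = 1"
proof (rule fps_ext)
  fix n
  define h where "h = (fps_exp 1 - 1 :: 'a fps)"
  define c where "c = fps_const (x / (1 - x)) * h"
  \<comment> \<open>\<open>c ^ k\<close> starts at degree \<open>k\<close>, so powers above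
    \<open>n\<close> do not reach the coefficient at \<open>n\<close>; a finite sum, correct only up
    to degree \<open>n\<close>, suffices.\<close>
  define G where "G = fps_const (1 / (1 - x)) * (\<Sum>k<Suc n. c ^ k)"
  have c0: "c $ 0 = 0" by (simp add: c_def h_def)
  have G: "G $ m = geom_moment x m / fact m" if "m \<le> n" for m
  proof -
    have "h ^ k $ m = fact k * of_nat (Stirling m k) / fact m" for k
      using fps_exp_minus_1_power_nth[of m k, where 'a = 'a] by (simp add: h_def field_simps)
    then have "G $ m = (\<Sum>k<Suc n. fact k * of_nat (Stirling m k) * (x ^ k / (1 - x) ^ (k + 1)) / fact m)"
      by (simp add: G_def c_def power_mult_distrib fps_sum_nth sum_distrib_left fps_const_power
           power_divide mult_ac del: sum.lessThan_Suc)
    also have "\<dots> = (\<Sum>k=0..m. fact k * of_nat (Stirling m k) * (x ^ k / (1 - x) ^ (k + 1)) / fact m)"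
      using that by (intro sum.mono_neutral_right) auto
    finally show ?thesis by (simp add: geom_moment_def sum_divide_distrib)
  qed
  have "1 - fps_const x * fps_exp 1 = fps_const (1 - x) * (1 - c)"
    using assms by (simp add: c_def h_def fps_eq_iff field_simps)
  then have "(1 - fps_const x * fps_exp 1) * G =
      (fps_const (1 - x) * fps_const (1 / (1 - x))) * ((1 - c) * (\<Sum>k<Suc n. c ^ k))"
    by (simp add: G_def mult_ac)
  also have "\<dots> = 1 - c ^ Suc n"
    using assms by (simp add: one_diff_power_eq del: power_Suc sum.lessThan_Suc)
  finally have eq: "(1 - fps_const x * fps_exp 1) * G = 1 - c ^ Suc n" .
  have "((1 - fps_const x * fps_exp 1) * Abs_fps (\<lambda>m. geom_moment x m / fact m)) $ n =
        ((1 - fps_const x * fps_exp 1) * G) $ n"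
    unfolding fps_mult_nth by (intro sum.cong refl) (simp add: G)
  also have "\<dots> = 1 $ n"
    unfolding eq using startsby_zero_power_prefix[OF c0, of "Suc n"] by (simp del: power_Suc)
  finally show "((1 - fps_const x * fps_exp 1) * Abs_fps (\<lambda>m. geom_moment x m / fact m)) $ n = 1 $ n" .
qed

text \<open>As \<open>m\<close> varies, the left sides have the generating function
  \<open>(1 - E^n) * \<Phi>\<close> with \<open>E = x exp T\<close>, a finite geometric sum. The
  factor \<open>exp (n T)\<close> of \<open>E^n\<close> becomes the binomial convolution with powers
  of \<open>n\<close>.\<close>

lemma sum_power_mult_geometric:
  fixes x :: "'a::field_char_0"
  assumes "x \<noteq> 1"
  shows "(\<Sum>l<n. of_nat l ^ m * x ^ l) =
    geom_moment x m - x ^ n * (\<Sum>i=0..m. of_nat (m choose i) * geom_moment x (m - i) * of_nat n ^ i)"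
proof -
  define E where "E = fps_const x * fps_exp (1::'a)"
  define \<Phi> where "\<Phi> = Abs_fps (\<lambda>m. geom_moment x m / fact m)"
  have pw: "E ^ l = fps_const (x ^ l) * fps_exp (of_nat l)" for l
    by (simp add: E_def power_mult_distrib fps_const_power fps_exp_power_mult)
  have inv: "(1 - E) * \<Phi> = 1"
    using geom_moment_egf[OF assms] by (simp add: E_def \<Phi>_def)
  have "(\<Sum>l<n. E ^ l) = (1 - E) * \<Phi> * (\<Sum>l<n. E ^ l)"
    by (simp add: inv)
  also have "\<dots> = (1 - E ^ n) * \<Phi>"
    by (simp add: one_diff_power_eq mult_ac)
  also have "\<dots> = \<Phi> - fps_const (x ^ n) * (fps_exp (of_nat n) * \<Phi>)"
    by (simp add: pw algebra_simps)
  finally have "(\<Sum>l<n. E ^ l) $ m = (\<Phi> - fps_const (x ^ n) * (fps_exp (of_nat n) * \<Phi>)) $ m"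
    by simp
  then have "(\<Sum>l<n. x ^ l * (of_nat l ^ m / fact m)) = geom_moment x m / fact m -
      x ^ n * (\<Sum>i=0..m. of_nat n ^ i / fact i * (geom_moment x (m - i) / fact (m - i)))"
    unfolding fps_sum_nth pw fps_sub_nth fps_mult_left_const_nth
    by (simp add: fps_mult_nth \<Phi>_def)
  then have "fact m * (\<Sum>l<n. x ^ l * (of_nat l ^ m / fact m)) = geom_moment x m -
      x ^ n * (\<Sum>i=0..m. fact m * (of_nat n ^ i / fact i * (geom_moment x (m - i) / fact (m - i))))"
    by (simp add: right_diff_distrib sum_distrib_left mult_ac)
  moreover have "(\<Sum>i=0..m. fact m * (of_nat n ^ i / fact i * (geom_moment x (m - i) / fact (m - i)))) =
      (\<Sum>i=0..m. of_nat (m choose i) * geom_moment x (m - i) * of_nat n ^ i)"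
    by (intro sum.cong refl) (simp add: binomial_fact field_simps)
  moreover have "fact m * (\<Sum>l<n. x ^ l * (of_nat l ^ m / fact m)) = (\<Sum>l<n. of_nat l ^ m * x ^ l)"
    by (simp add: sum_distrib_left mult_ac)
  ultimately show ?thesis by simp
qed

text \<open>Both sums of the theorem reduce to weighted power sums of this shape. The coefficients
  \<open>B i\<close> do not depend on \<open>n\<close>; they are the source of the
  \<open>A i\<close> and, up to a boundary term, of the \<open>N i\<close>.\<close>

lemma sum_moments_geometric:
  fixes x :: "'a::field_char_0" and c :: "nat \<Rightarrow> 'a" and s n :: nat
  assumes "x \<noteq> 1"
  defines "B \<equiv> \<lambda>i. \<Sum>m\<in>{i..<s}. c m * of_nat (m choose i) * geom_moment x (m - i)"
  shows "(\<Sum>m<s. c m * (\<Sum>l<n. of_nat l ^ m * x ^ l)) = B 0 - x ^ n * (\<Sum>i<s. B i * of_nat n ^ i)"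
proof -
  let ?f = "\<lambda>m i. c m * (of_nat (m choose i) * geom_moment x (m - i) * of_nat n ^ i)"
  have "(\<Sum>m<s. \<Sum>i=0..m. ?f m i) = (\<Sum>m<s. \<Sum>i\<in>{i\<in>{..<s}. i \<le> m}. ?f m i)"
    by (intro sum.cong refl) auto
  also have "\<dots> = (\<Sum>i<s. \<Sum>m\<in>{m\<in>{..<s}. i \<le> m}. ?f m i)"
    by (rule sum.swap_restrict) auto
  also have "\<dots> = (\<Sum>i<s. B i * of_nat n ^ i)"
    unfolding B_def sum_distrib_right by (intro sum.cong refl) (auto simp: mult_ac)
  finally have "(\<Sum>m<s. \<Sum>i=0..m. ?f m i) = (\<Sum>i<s. B i * of_nat n ^ i)" .
  moreover have "(\<Sum>m<s. c m * (\<Sum>l<n. of_nat l ^ m * x ^ l)) =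
      (\<Sum>m<s. c m * geom_moment x m) - x ^ n * (\<Sum>m<s. \<Sum>i=0..m. ?f m i)"
    unfolding sum_power_mult_geometric[OF assms(1)]
    by (simp add: right_diff_distrib sum_subtractf sum_distrib_left mult_ac)
  moreover have "B 0 = (\<Sum>m<s. c m * geom_moment x m)"
    by (simp add: B_def atLeast0LessThan)
  ultimately show ?thesis by simp
qed

section \<open>\<open>p\<close>-adic integers and congruences\<close>

lemma pval_1 [simp]: "pval (1 :: 'p::prime_card padic) = 0"
  using pval_of_rat[where 'p = 'p, of 1] by (simp add: prime_card)

lemma pval_minus [simp]: "pval (- x :: 'p::prime_card padic) = pval x"
proof -
  have "pval (- 1 :: 'p padic) = 0"
    using pval_of_rat[where 'p = 'p, of "- 1"] by (simp add: prime_card of_rat_minus)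
  then show ?thesis using pval_mult[of "- 1" x] by simp
qed

lemma multiplicity_int_of_nat:
  assumes "n > 0" "p > 1"
  shows "multiplicity (int p) (int n) = multiplicity p n"
proof (rule multiplicity_eqI)
  show "int p ^ multiplicity p n dvd int n"
    using multiplicity_dvd[of p n] by (metis int_dvd_int_iff of_nat_power)
  have "\<not> p ^ Suc (multiplicity p n) dvd n"
    using assms by (subst power_dvd_iff_le_multiplicity) auto
  then show "\<not> int p ^ Suc (multiplicity p n) dvd int n"
    by (metis int_dvd_int_iff of_nat_power)
qed

lemma pval_of_nat:
  "n > 0 \<Longrightarrow> pval (of_nat n :: 'p::prime_card padic) = Fin (int (multiplicity CARD('p) n))"
  using rat_pval_divide_int[OF prime_card[where 'a = 'p], of "int n" 1]
    pval_of_rat[where 'p = 'p, of "of_nat n"] prime_gt_1_nat[OF prime_card[where 'a = 'p]]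
  by (simp add: multiplicity_int_of_nat)

lemma pval_ne_Minf [simp]: "pval x \<noteq> Minf"
  by (cases rule: padic_cases[where x = x]) auto

lemma pval_prime_power: "pval (of_nat CARD('p) ^ k :: 'p::prime_card padic) = Fin (int k)"
  by (induction k) (simp_all add: pval_mult zero_extended_def)

lemma padic_ints_add [intro]: "x \<in> padic_ints \<Longrightarrow> y \<in> padic_ints \<Longrightarrow> x + y \<in> padic_ints"
  unfolding padic_ints_def using pval_add[of x y] by (auto simp: min_def split: if_splits intro: order_trans)

lemma padic_ints_mult [intro]: "x \<in> padic_ints \<Longrightarrow> y \<in> padic_ints \<Longrightarrow> x * y \<in> padic_ints"
  unfolding padic_ints_def by (cases "pval x"; cases "pval y") (auto simp: pval_mult zero_extended_def)

lemma padic_ints_minus [intro]: "x \<in> padic_ints \<Longrightarrow> - x \<in> padic_ints"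
  by (simp add: padic_ints_def)

lemma padic_ints_diff [intro]: "x \<in> padic_ints \<Longrightarrow> y \<in> padic_ints \<Longrightarrow> x - y \<in> padic_ints"
  using padic_ints_add[of x "- y"] by auto

lemma padic_ints_0 [simp, intro]: "0 \<in> padic_ints"
  by (simp add: padic_ints_def)

lemma padic_ints_1 [simp, intro]: "1 \<in> padic_ints"
  by (simp add: padic_ints_def)

lemma padic_ints_power [intro]: "x \<in> padic_ints \<Longrightarrow> x ^ n \<in> padic_ints"
  by (induction n) auto

lemma padic_ints_sum [intro]: "(\<And>i. i \<in> I \<Longrightarrow> f i \<in> padic_ints) \<Longrightarrow> sum f I \<in> padic_ints"
  by (induction I rule: infinite_finite_induct) auto

lemma padic_ints_of_nat [simp, intro]: "of_nat n \<in> padic_ints"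
  by (induction n) auto

lemma padic_ints_of_int [simp, intro]: "of_int n \<in> padic_ints"
  by (cases n) auto

lemma padic_ints_divide:
  assumes "b \<noteq> 0" "pval b \<le> pval a"
  shows "a / b \<in> padic_ints"
proof -
  have "pval a = pval (a / b) + pval b"
    using assms(1) pval_mult[of "a / b" b] by simp
  then show ?thesis
    using assms pval_ne_Minf[of "a / b"] pval_ne_Minf[of b]
    by (cases "pval (a / b)"; cases "pval b") (auto simp: padic_ints_def zero_extended_def simp del: pval_ne_Minf)
qed

text \<open>Trades the valuation bound for divisibility by \<open>p ^ k\<close>, so that proving a
  congruence means exhibiting an integral cofactor.\<close>

lemma padic_cong_iff:
  "padic_cong k a b \<longleftrightarrow> (\<exists>c\<in>padic_ints. a - b = of_nat CARD('p) ^ k * (c :: 'p::prime_card padic))"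
proof
  let ?P = "of_nat CARD('p) :: 'p padic"
  assume "padic_cong k a b"
  then have "(a - b) / ?P ^ k \<in> padic_ints"
    by (intro padic_ints_divide) (simp_all add: padic_cong_def pval_prime_power)
  moreover have "a - b = ?P ^ k * ((a - b) / ?P ^ k)" by simp
  ultimately show "\<exists>c\<in>padic_ints. a - b = ?P ^ k * c" by blast
next
  assume "\<exists>c\<in>padic_ints. a - b = of_nat CARD('p) ^ k * c"
  then obtain c where c: "0 \<le> pval c" "a - b = of_nat CARD('p) ^ k * c"
    by (auto simp: padic_ints_def)
  then show "padic_cong k a b"
    by (cases "pval c") (auto simp: padic_cong_def pval_mult pval_prime_power zero_extended_def)
qed

lemma padic_congI:
  fixes a b :: "'p::prime_card padic"
  shows "a - b = of_nat CARD('p) ^ k * c \<Longrightarrow> c \<in> padic_ints \<Longrightarrow> padic_cong k a b"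
  by (auto simp: padic_cong_iff)

lemma padic_cong_refl [simp, intro]: "padic_cong k a a"
  by (simp add: padic_cong_def)

lemma padic_cong_sym: "padic_cong k a b \<Longrightarrow> padic_cong k b a"
  unfolding padic_cong_def using pval_minus[of "a - b"] by simp

lemma padic_cong_add: "padic_cong k a b \<Longrightarrow> padic_cong k c d \<Longrightarrow> padic_cong k (a + c) (b + d)"
  unfolding padic_cong_def add_diff_add using pval_add[of "a - b" "c - d"]
  by (meson min.boundedI order_trans)

lemma padic_cong_trans [trans]: "padic_cong k a b \<Longrightarrow> padic_cong k b c \<Longrightarrow> padic_cong k a c"
  using padic_cong_add[of k a b b c] by (simp add: padic_cong_def)

lemma padic_cong_diff: "padic_cong k a b \<Longrightarrow> padic_cong k c d \<Longrightarrow> padic_cong k (a - c) (b - d)"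
  using padic_cong_add[of k a b "- c" "- d"] padic_cong_sym[of k c d] by (simp add: padic_cong_def)

lemma padic_cong_sum: "(\<And>i. i \<in> I \<Longrightarrow> padic_cong k (f i) (g i)) \<Longrightarrow> padic_cong k (sum f I) (sum g I)"
  by (induction I rule: infinite_finite_induct) (auto intro: padic_cong_add)

lemma padic_cong_mult:
  assumes "padic_cong k a b" "padic_cong k c d" "b \<in> padic_ints" "c \<in> padic_ints"
  shows "padic_cong k (a * c) (b * d)"
proof -
  obtain e f where e: "a - b = of_nat CARD('a) ^ k * e" "c - d = of_nat CARD('a) ^ k * f"
    "e \<in> padic_ints" "f \<in> padic_ints"
    using assms(1,2) by (auto simp: padic_cong_iff)
  have "a * c - b * d = (a - b) * c + b * (c - d)" by (simp add: algebra_simps)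
  also have "\<dots> = of_nat CARD('a) ^ k * (e * c + b * f)" by (simp add: e algebra_simps)
  finally show ?thesis using e assms(3,4) by (intro padic_congI[of _ _ _ "e * c + b * f"]) auto
qed

lemma padic_cong_mult_left:
  assumes "padic_cong k a b" "c \<in> padic_ints"
  shows "padic_cong k (c * a) (c * b)"
proof -
  obtain d where d: "d \<in> padic_ints" "a - b = of_nat CARD('a) ^ k * d"
    using assms(1) by (auto simp: padic_cong_iff)
  have "c * a - c * b = c * (a - b)" by (simp add: right_diff_distrib)
  also have "\<dots> = of_nat CARD('a) ^ k * (c * d)" unfolding d(2) by (simp add: mult_ac)
  finally show ?thesis using assms(2) d(1) by (auto intro: padic_congI)
qed

lemma padic_cong_ints:
  assumes "padic_cong k a b" "b \<in> padic_ints"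
  shows "a \<in> padic_ints"
proof -
  obtain d where d: "d \<in> padic_ints" "a - b = of_nat CARD('a) ^ k * d"
    using assms(1) by (auto simp: padic_cong_iff)
  have "a = of_nat CARD('a) ^ k * d + b" using d(2) by (simp add: diff_eq_eq)
  then show ?thesis using assms(2) d(1) by (simp add: padic_ints_add padic_ints_mult padic_ints_power)
qed

lemma padic_cong_power:
  assumes "padic_cong k a b" "b \<in> padic_ints"
  shows "padic_cong k (a ^ n) (b ^ n)"
  using assms padic_cong_ints[OF assms]
  by (induction n) (auto intro!: padic_cong_mult)

section \<open>Legendre's formula and the denominators of logarithm and exponential\<close>

lemma multiplicity_fact_eq:
  fixes p :: nat
  assumes "prime p"
  shows "multiplicity p (fact n) = n div p + multiplicity p (fact (n div p))"
proof (induction n)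
  case (Suc n)
  have m: "multiplicity p (fact (Suc k)) = multiplicity p (Suc k) + multiplicity p (fact k)" for k
    using assms prime_elem_multiplicity_mult_distrib[of p "Suc k" "fact k"] by simp
  show ?case
  proof (cases "p dvd Suc n")
    case True
    \<comment> \<open>Reaching the multiple \<open>p t\<close> raises the valuation by one plus that
      of \<open>t\<close>: the one matches the growth of \<open>n div p\<close>, the rest that of
      its factorial.\<close>
    then obtain t where t: "Suc n = p * t" by blast
    then obtain u where u: "t = Suc u" by (cases t) auto
    have p1: "p > 1" using assms prime_gt_1_nat by blast
    have "multiplicity p (Suc n) = Suc (multiplicity p t)"
      using t u p1 multiplicity_times_same[of t p] by (simp del: One_nat_def mult_Suc_right)
    moreover have "n div p = u" "Suc n div p = Suc u"
    proof -
      show "Suc n div p = Suc u" using t u p1 by (metis nonzero_mult_div_cancel_left not_one_less_zero)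
      then show "n div p = u" using True by (simp add: div_Suc dvd_eq_mod_eq_0)
    qed
    ultimately show ?thesis using Suc.IH m[of n] m[of u] u by simp
  next
    case False
    then show ?thesis using Suc.IH m[of n]
      by (simp add: not_dvd_imp_multiplicity_0 div_Suc dvd_eq_mod_eq_0)
  qed
qed simp

text \<open>For \<open>q = n div p > 0\<close> induction gives
  \<open>v(n!) = q + v(q!) < 2 q <= n\<close>. Strictness is what makes
  \<open>p ^ (n - 1) / n!\<close> integral.\<close>

lemma multiplicity_fact_less:
  fixes p :: nat
  assumes "prime p" "n > 0"
  shows "multiplicity p (fact n) < n"
  using assms(2)
proof (induction n rule: less_induct)
  case (less n)
  have p2: "p \<ge> 2" using assms(1) by (rule prime_ge_2_nat)
  show ?case
  proof (cases "n div p = 0")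
    case True
    then show ?thesis using multiplicity_fact_eq[OF assms(1), of n] less.prems by simp
  next
    case False
    have "n div p < n" using less.prems p2 by simp
    then have "multiplicity p (fact (n div p)) < n div p" using less.IH False by blast
    moreover have "2 * (n div p) \<le> n"
      using p2 by (meson div_times_less_eq_dividend mult.commute mult_le_mono1 order_trans times_div_less_eq_dividend)
    ultimately show ?thesis using multiplicity_fact_eq[OF assms(1), of n] by linarith
  qed
qed

lemma prime_power_div_fact_in_padic_ints:
  "of_nat CARD('p) ^ n / fact (Suc n) \<in> (padic_ints :: 'p::prime_card padic set)"
proof (rule padic_ints_divide)
  have "pval (fact (Suc n) :: 'p padic) = Fin (int (multiplicity CARD('p) (fact (Suc n))))"
    using pval_of_nat[where 'p = 'p, of "fact (Suc n)"] by (simp del: fact_Suc)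
  then show "pval (fact (Suc n) :: 'p padic) \<le> pval (of_nat CARD('p) ^ n :: 'p padic)"
    using multiplicity_fact_less[OF prime_card[where 'a = 'p], of "Suc n"]
    by (simp add: pval_prime_power del: fact_Suc)
qed (simp del: fact_Suc)

lemma prime_power_div_in_padic_ints:
  "of_nat CARD('p) ^ n / of_nat (Suc n) \<in> (padic_ints :: 'p::prime_card padic set)"
proof -
  have "of_nat CARD('p) ^ n / of_nat (Suc n) =
      of_nat CARD('p) ^ n / fact (Suc n) * (of_nat (fact n) :: 'p padic)"
    by (simp del: of_nat_Suc)
  then show ?thesis using prime_power_div_fact_in_padic_ints[where 'p = 'p, of n] by (metis padic_ints_mult padic_ints_of_nat)
qed

lemma inverse_of_nat_in_padic_ints:
  assumes "coprime k CARD('p)"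
  shows "1 / of_nat k \<in> (padic_ints :: 'p::prime_card padic set)"
proof -
  have k: "k > 0" "\<not> CARD('p) dvd k"
    using assms prime_gt_1_nat[OF prime_card[where 'a = 'p]]
    by (auto simp: coprime_absorb_right intro: Nat.gr0I)
  show ?thesis
    using k by (intro padic_ints_divide) (simp_all add: pval_of_nat not_dvd_imp_multiplicity_0 zero_extended_def)
qed

section \<open>Powers of \<open>p\<close>-adic units\<close>

lemma Fin_le_pval_PadicI:
  assumes "pcauchy CARD('p) X" "\<And>n. n \<ge> N \<Longrightarrow> Fin k \<le> rat_pval CARD('p) (X n)"
  shows "Fin k \<le> pval (Padic X :: 'p::prime_card padic)"
proof (cases "pvanishes CARD('p) X")
  case True
  then show ?thesis using assms(1) by (simp add: pval.abs_eq padic_rel_def)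
next
  case False
  obtain v M where M: "\<And>n. n \<ge> M \<Longrightarrow> rat_pval CARD('p) (X n) = Fin v"
    by (rule pcauchy_not_pvanishes[OF prime_card assms(1) False]) (rule that)
  then have "pval (Padic X :: 'p padic) = Fin v"
    by (intro pval_Padic assms(1)) (auto simp: eventually_sequentially)
  then show ?thesis using M[of "max M N"] assms(2)[of "max M N"] by simp
qed

text \<open>Density of the rationals: a late enough term of a representing Cauchy sequence serves as
  \<open>q\<close>.\<close>

lemma padic_cong_of_rat_exists:
  fixes x :: "'p::prime_card padic"
  obtains q where "padic_cong k x (of_rat q)"
proof -
  obtain X where X: "pcauchy CARD('p) X" "x = Padic X" using rep_padic[of x] by metis
  obtain N where N: "\<And>m n. m \<ge> N \<Longrightarrow> n \<ge> N \<Longrightarrow> Fin (int k) \<le> rat_pval CARD('p) (X m - X n)"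
    using X(1) unfolding pcauchy_def by blast
  have c: "pcauchy CARD('p) (\<lambda>n. X n + - X N)"
    using X(1) by (intro pcauchy_add prime_card) simp_all
  have "x - of_rat (X N) = x + of_rat (- X N)" by (simp add: of_rat_minus)
  also have "\<dots> = Padic (\<lambda>n. X n + - X N)"
    unfolding X(2) of_rat_padic by (subst plus_padic.abs_eq) (simp_all add: padic_rel_def X(1))
  finally have "Fin (int k) \<le> pval (x - of_rat (X N))"
    using Fin_le_pval_PadicI[OF c, of N "int k"] N by simp
  then show ?thesis using that by (simp add: padic_cong_def)
qed

text \<open>The residue field is that of the integers modulo \<open>p\<close>: a rational
  approximation \<open>a / b\<close> has denominator prime to \<open>p\<close>, so \<open>b\<close>
  can be inverted modulo \<open>p\<close>.\<close>

lemma padic_cong_of_nat_exists: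
  fixes x :: "'p::prime_card padic"
  assumes "x \<in> padic_ints"
  obtains c :: nat where "padic_cong 1 x (of_nat c)"
proof -
  let ?p = "int CARD('p)"
  have p: "prime ?p" using prime_card[where 'a = 'p] by simp
  obtain q where q: "padic_cong 1 x (of_rat q)" by (rule padic_cong_of_rat_exists)
  obtain a b where ab: "quotient_of q = (a, b)" by (cases "quotient_of q")
  have b: "b > 0" and qab: "q = of_int a / of_int b" and co: "coprime a b"
    using ab by (auto simp: quotient_of_denom_pos quotient_of_div quotient_of_coprime)
  have int: "of_rat q \<in> (padic_ints :: 'p padic set)"
    using padic_cong_ints[OF padic_cong_sym[OF q] assms] .
  have "\<not> ?p dvd b"
  proof
    \<comment> \<open>In lowest terms \<open>p\<close> would divide \<open>b\<close> only, so the
      valuation of \<open>q\<close> would be negative.\<close>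
    assume pb: "?p dvd b"
    then have "\<not> ?p dvd a" using co p by (meson coprime_common_divisor not_prime_unit)
    moreover have "multiplicity ?p b > 0"
      using pb b p by (simp add: prime_multiplicity_gt_zero_iff)
    moreover have "a \<noteq> 0" using calculation by auto
    ultimately have "\<not> 0 \<le> rat_pval CARD('p) q"
      using ab qab b by (simp add: rat_pval_def not_dvd_imp_multiplicity_0 zero_extended_def)
    then show False using int by (simp add: padic_ints_def pval_of_rat)
  qed
  then have "coprime b ?p" using p by (meson coprime_commute prime_imp_coprime)
  then obtain d where d: "[b * d = 1] (mod ?p)" using cong_solve_coprime_int by blast
  define c where "c = nat ((a * d) mod ?p)"
  have "[int c = a * d] (mod ?p)" by (simp add: c_def cong_def prime_gt_0_int[OF p])
  then have "[b * int c = b * (a * d)] (mod ?p)" by (rule cong_scalar_left)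
  also have "[b * (a * d) = a * (b * d)] (mod ?p)" by (simp add: mult_ac)
  also have "[a * (b * d) = a * 1] (mod ?p)" using d by (rule cong_scalar_left)
  finally have "[a = b * int c] (mod ?p)" by (simp add: cong_sym)
  then obtain e where e: "a - b * int c = ?p * e" by (metis cong_iff_dvd_diff dvdE)
  have bu: "1 / of_int b \<in> (padic_ints :: 'p padic set)"
  proof -
    have "coprime (nat b) CARD('p)" using \<open>coprime b ?p\<close> b
      by (metis coprime_int_iff int_nat_eq less_imp_le)
    then show ?thesis using inverse_of_nat_in_padic_ints[of "nat b", where 'p = 'p] b by simp
  qed
  have "of_rat q - of_nat c = (of_int (a - b * int c) / of_int b :: 'p padic)"
    using b by (simp add: qab of_rat_divide field_simps)
  also have "\<dots> = of_nat CARD('p) ^ 1 * (of_int e * (1 / of_int b))" by (simp add: e)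
  finally have "padic_cong 1 (of_rat q) (of_nat c :: 'p padic)"
    using bu by (intro padic_congI[of _ _ _ "of_int e * (1 / of_int b)"]) blast+
  then show ?thesis using that padic_cong_trans[OF q] by blast
qed

text \<open>Fermat's little theorem for a natural number in the same residue class, carried back
  along the congruence.\<close>

lemma padic_cong_prime_power_self:
  fixes x :: "'p::prime_card padic"
  assumes "x \<in> padic_ints"
  shows "padic_cong 1 (x ^ CARD('p)) x"
proof -
  obtain c :: nat where c: "padic_cong 1 x (of_nat c)" by (rule padic_cong_of_nat_exists[OF assms])
  have p: "prime CARD('p)" by (rule prime_card)
  have "[c ^ CARD('p) = c] (mod CARD('p))"
  proof (cases "CARD('p) dvd c")
    case True
    then show ?thesis using p prime_gt_0_nat[OF p]
      by (simp add: cong_def dvd_eq_mod_eq_0[symmetric] dvd_power_same[THEN dvd_trans[rotated]] prime_dvd_power_iff)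
  next
    case False
    then have "[c * c ^ (CARD('p) - 1) = c * 1] (mod CARD('p))"
      by (intro cong_scalar_left fermat_theorem p)
    then show ?thesis using prime_gt_0_nat[OF p] by (simp add: power_eq_if)
  qed
  then have "[int (c ^ CARD('p)) = int c] (mod int CARD('p))" by (simp only: cong_int_iff)
  then obtain e where e: "int (c ^ CARD('p)) - int c = int CARD('p) * e"
    by (metis cong_iff_dvd_diff dvdE)
  have "of_nat c ^ CARD('p) - of_nat c = (of_int (int (c ^ CARD('p)) - int c) :: 'p padic)" by simp
  also have "\<dots> = of_nat CARD('p) ^ 1 * of_int e" unfolding e by simp
  finally have "padic_cong 1 (of_nat c ^ CARD('p)) (of_nat c :: 'p padic)" by (rule padic_congI) simp
  then show ?thesis
    using padic_cong_power[OF c, of "CARD('p)"] c by (meson padic_cong_sym padic_cong_trans padic_ints_of_nat)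
qed

lemma padic_fermat:
  fixes y :: "'p::prime_card padic"
  assumes "pval y = 0"
  shows "padic_cong 1 (y ^ (CARD('p) - 1)) 1"
proof -
  have y: "y \<noteq> 0" "y \<in> padic_ints" using assms by (auto simp: padic_ints_def zero_extended_def)
  have i: "1 / y \<in> padic_ints" using y assms by (intro padic_ints_divide) auto
  have "padic_cong 1 (1 / y * y ^ CARD('p)) (1 / y * y)"
    using padic_cong_mult_left[OF padic_cong_prime_power_self[OF y(2)] i] .
  then show ?thesis using y prime_gt_0_nat[OF prime_card[where 'a = 'p]] by (simp add: power_eq_if)
qed

text \<open>The binomial theorem to second order; only the integrality of the remainder is ever
  used.\<close>

lemma one_plus_power_expand:
  fixes t :: "'p::prime_card padic"
  assumes "t \<in> padic_ints"
  obtains c where "c \<in> padic_ints" "(1 + t) ^ n = 1 + of_nat n * t + t\<^sup>2 * c"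
proof -
  have "\<exists>c\<in>padic_ints. (1 + t) ^ n = 1 + of_nat n * t + t\<^sup>2 * c"
  proof (induction n)
    case (Suc n)
    then obtain c where c: "c \<in> padic_ints" "(1 + t) ^ n = 1 + of_nat n * t + t\<^sup>2 * c" by blast
    have "(1 + t) ^ Suc n = 1 + of_nat (Suc n) * t + t\<^sup>2 * (of_nat n + c + t * c)"
      by (simp add: c(2) algebra_simps power2_eq_square)
    then show ?case using c(1) assms by blast
  qed (auto intro: bexI[of _ 0])
  then show ?thesis using that by blast
qed

text \<open>For \<open>u = 1 + p t\<close> the linear term \<open>p * p t\<close> and the remainder
  \<open>(p t)^2 c\<close> both contain \<open>p^2\<close>. With \<open>u = y ^ (p - 1)\<close> this
  makes \<open>y ^ (p * (p - 1)) - 1\<close> divisible by \<open>p^2\<close>.\<close>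

lemma padic_cong_prime_power_1:
  fixes u :: "'p::prime_card padic"
  assumes "padic_cong 1 u 1"
  shows "padic_cong 2 (u ^ CARD('p)) 1"
proof -
  let ?P = "of_nat CARD('p) :: 'p padic"
  obtain t where t: "t \<in> padic_ints" "u - 1 = ?P ^ 1 * t"
    using assms by (auto simp: padic_cong_iff)
  obtain c where c: "c \<in> padic_ints" "(1 + (u - 1)) ^ CARD('p) = 1 + ?P * (u - 1) + (u - 1)\<^sup>2 * c"
    by (rule one_plus_power_expand[of "u - 1" "CARD('p)"]) (use t in auto)
  have "u ^ CARD('p) = 1 + ?P * (u - 1) + (u - 1)\<^sup>2 * c" using c(2) by simp
  then have "u ^ CARD('p) - 1 = ?P\<^sup>2 * (t + t\<^sup>2 * c)"
    unfolding t(2) by (simp add: algebra_simps power2_eq_square)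
  then show ?thesis using t c by (intro padic_congI[of _ _ _ "t + t\<^sup>2 * c"]) auto
qed

text \<open>This is where the prime must be odd: \<open>-1\<close> is a square root of 1.\<close>

lemma padic_prime_root_of_unity:
  fixes u :: "'p::prime_card padic"
  assumes "CARD('p) > 2" "u \<in> padic_ints" "u ^ CARD('p) = 1"
  shows "u = 1"
proof (rule ccontr)
  assume ne: "u \<noteq> 1"
  let ?p = "CARD('p)" and ?P = "of_nat CARD('p) :: 'p padic"
  have "padic_cong 1 u 1"
    using padic_cong_sym[OF padic_cong_prime_power_self[OF assms(2)]] assms(3) by simp
  then obtain t where t: "t \<in> padic_ints" "u - 1 = ?P ^ 1 * t"
    by (auto simp: padic_cong_iff)
  have "\<exists>c\<in>padic_ints. u ^ n = 1 + of_nat n * (u - 1) + (u - 1)\<^sup>2 * c" for n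
    
  proof -
    have "u - 1 \<in> padic_ints" using assms(2) by auto
    from one_plus_power_expand[OF this, of n] show ?thesis by (metis add.commute diff_add_cancel)
  qed
  then have "\<forall>n. \<exists>c. c \<in> padic_ints \<and> u ^ n = 1 + of_nat n * (u - 1) + (u - 1)\<^sup>2 * c" by blast
  from choice[OF this] obtain c
    where c: "\<And>n. c n \<in> padic_ints" "\<And>n. u ^ n = 1 + of_nat n * (u - 1) + (u - 1)\<^sup>2 * c n"
    by blast
  \<comment> \<open>Oddness gives \<open>0 + ... + (p - 1) = p h\<close>, so the linear terms of
    \<open>1 + u + ... + u^(p-1)\<close> gain a second factor \<open>p\<close>. This sum is then
    \<open>p\<close> times an element congruent to 1 modulo \<open>p\<close>, whereas
    \<open>u ^ p = 1\<close> with \<open>u\<close> other than 1 makes it vanish.\<close>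
  have "odd ?p" using assms(1) prime_card[where 'a = 'p] by (metis prime_odd_nat)
  then obtain h where h: "?p = 2 * h + 1" by (blast elim: oddE)
  have "(\<Sum>i<?p. of_nat i) = ?P * (of_nat h :: 'p padic)"
  proof -
    have "\<Sum>{..<2 * h + 1} = (2 * h + 1) * h" by (induction h) auto
    then show ?thesis unfolding of_nat_sum[symmetric] h of_nat_mult[symmetric] by (simp only:)
  qed
  then have lin: "(\<Sum>i<?p. of_nat i * (u - 1)) = ?P * of_nat h * (?P * t)"
    using t(2) by (simp add: sum_distrib_right[symmetric])
  have "(u - 1) * (\<Sum>i<?p. u ^ i) = 0"
    using assms(3) power_diff_1_eq[of u ?p] by simp
  then have "0 = (\<Sum>i<?p. u ^ i)" using ne by simp
  also have "\<dots> = (\<Sum>i<?p. 1 + of_nat i * (u - 1) + (u - 1)\<^sup>2 * c i)"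
    by (rule sum.cong[OF refl]) (rule c(2))
  also have "\<dots> = ?P + ?P * of_nat h * (?P * t) + (?P * t)\<^sup>2 * (\<Sum>i<?p. c i)"
    using t(2) unfolding sum.distrib lin sum_distrib_left[symmetric] by simp
  also have "\<dots> = ?P * (1 + ?P * (of_nat h * t + t\<^sup>2 * (\<Sum>i<?p. c i)))"
    by (simp only: algebra_simps power2_eq_square mult_1)
  finally have "1 + ?P * (of_nat h * t + t\<^sup>2 * (\<Sum>i<?p. c i)) = 0" by simp
  then have "1 = ?P * - (of_nat h * t + t\<^sup>2 * (\<Sum>i<?p. c i))"
    by (simp only: mult_minus_right eq_neg_iff_add_eq_0)
  moreover have "- (of_nat h * t + t\<^sup>2 * (\<Sum>i<?p. c i)) \<in> padic_ints"
    by (intro padic_ints_minus padic_ints_add padic_ints_mult padic_ints_power padic_ints_sum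
        padic_ints_of_nat c(1) t(1))
  ultimately have "padic_cong 1 (1 :: 'p padic) 0" unfolding padic_cong_iff by (metis diff_zero power_one_right)
  then show False by (simp add: padic_cong_def zero_extended_def)
qed

section \<open>Truncated logarithm and exponential\<close>

text \<open>\<open>fps_ln 1\<close> is the compositional inverse of \<open>exp T - 1\<close>; this
  settles the case of exponent 1, and composition respects powers.\<close>

lemma fps_exp_compose_ln:
  "fps_exp (of_nat j) oo fps_ln 1 = (1 + fps_X :: 'a::field_char_0 fps) ^ j"
proof -
  have "(fps_exp 1 - 1) oo fps_inv (fps_exp 1 - 1 :: 'a fps) = fps_X"
    by (rule fps_inv_right) simp_all
  then have "(fps_exp 1 - 1) oo (fps_ln 1 :: 'a fps) = fps_X"
    by (simp add: fps_ln_fps_exp_inv)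
  then have "fps_exp 1 oo (fps_ln 1 :: 'a fps) = 1 + fps_X"
    by (simp add: fps_compose_sub_distrib algebra_simps)
  moreover have "fps_exp (of_nat j) = (fps_exp 1 :: 'a fps) ^ j"
    by (simp add: fps_exp_power_mult)
  ultimately show ?thesis using fps_compose_power[of "fps_ln 1 :: 'a fps" "fps_exp 1" j] by simp
qed

lemma fps_power_nth_cong:
  fixes f g :: "'a::comm_ring_1 fps"
  assumes "\<And>k. k < s \<Longrightarrow> f $ k = g $ k" "k < s"
  shows "f ^ r $ k = g ^ r $ k"
  using assms(2)
proof (induction r arbitrary: k)
  case (Suc r)
  show ?case unfolding power_Suc fps_mult_nth
    by (rule sum.cong) (use Suc assms(1) in auto)
qed simp

text \<open>The series of \<open>log (1 + T)\<close> cut off below degree \<open>s\<close>. Its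
  value at \<open>y ^ (p * (p - 1)) - 1\<close>, divided by \<open>p^2\<close>, is what
  \<open>z\<close> approximates.\<close>

definition trunc_log :: "nat \<Rightarrow> 'a::field_char_0 poly" where
  "trunc_log s = (\<Sum>k\<in>{1..<s}. monom ((- 1) ^ (k + 1) / of_nat k) k)"

text \<open>A truncation of \<open>(exp (j L) - 1) / j\<close> for \<open>L = trunc_log s\<close>:
  index \<open>m\<close> stands for exponential term \<open>m + 1\<close>, with one factor
  \<open>j\<close> cancelled.\<close>

definition trunc_exp_log :: "nat \<Rightarrow> nat \<Rightarrow> 'a::field_char_0 poly" where
  "trunc_exp_log s j = (\<Sum>m<s - 1. smult (of_nat j ^ m / fact (Suc m)) (trunc_log s ^ Suc m))"

definition binomial_quotient :: "nat \<Rightarrow> 'a::field_char_0 poly" where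
  "binomial_quotient j = smult (1 / of_nat j) ([:1, 1:] ^ j - 1)"

lemma coeff_trunc_log:
  "coeff (trunc_log s) k = (if k \<in> {1..<s} then (- 1) ^ (k + 1) / of_nat k else 0)"
  by (simp add: trunc_log_def coeff_sum)

text \<open>Below degree \<open>s\<close> neither truncation is visible: the polynomial logarithm
  agrees with the series \<open>l\<close>, and \<open>l ^ r\<close> for \<open>r \<ge> s\<close> has
  no terms there. What remains is \<open>exp (j log (1 + T)) = (1 + T)^j\<close>.\<close>

lemma coeff_trunc_exp_log:
  assumes "j > 0" "k < s"
  shows "coeff (trunc_exp_log s j) k = coeff (binomial_quotient j :: 'a::field_char_0 poly) k"
proof -
  define l where "l = (fps_ln 1 :: 'a fps)"
  have l0: "l $ 0 = 0" by (simp add: l_def)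
  have ln: "coeff (trunc_log s ^ r) k = l ^ r $ k" for r
  proof -
    have "fps_of_poly (trunc_log s) $ i = l $ i" if "i < s" for i
      using that by (cases i) (auto simp: coeff_trunc_log l_def fps_ln_nth)
    from fps_power_nth_cong[OF this assms(2), of r]
    show ?thesis by (simp add: fps_of_poly_power[symmetric])
  qed
  have s: "s = Suc (s - 1)" using assms(2) by simp
  have "of_nat j * coeff (trunc_exp_log s j) k =
      (\<Sum>m<s - 1. of_nat j ^ Suc m / fact (Suc m) * (l ^ Suc m $ k))"
    by (simp add: trunc_exp_log_def coeff_sum ln sum_distrib_left mult_ac del: fact_Suc power_Suc)
       (simp add: mult_ac del: fact_Suc)
  \<comment> \<open>The sum over \<open>m\<close> lacks term 0 of the exponential; restoring it
    costs the subtracted \<open>1 $ k\<close>.\<close>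
  also have "\<dots> = (\<Sum>r<s. of_nat j ^ r / fact r * (l ^ r $ k)) - 1 $ k"
    by (subst (2) s, subst sum.lessThan_Suc_shift) simp
  also have "(\<Sum>r<s. of_nat j ^ r / fact r * (l ^ r $ k)) = (\<Sum>r=0..k. of_nat j ^ r / fact r * (l ^ r $ k))"
    using assms(2) startsby_zero_power_prefix[OF l0] by (intro sum.mono_neutral_right) auto
  also have "\<dots> = (fps_exp (of_nat j) oo l) $ k"
    by (simp add: fps_compose_nth)
  also have "\<dots> = coeff ([:1, 1:] ^ j) k"
  proof -
    have "(1 + fps_X :: 'a fps) ^ j = fps_of_poly ([:1, 1:] ^ j)"
      by (simp add: fps_of_poly_power fps_of_poly_pCons)
    then show ?thesis unfolding l_def fps_exp_compose_ln by (metis fps_of_poly_nth)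
  qed
  finally show ?thesis using assms(1) by (cases "k = 0") (simp_all add: binomial_quotient_def field_simps)
qed

text \<open>These are the polynomials \<open>q(T)\<close> for which \<open>q(pT)\<close> has integral coefficients.\<close>

definition scaled_integral :: "'p::prime_card padic poly \<Rightarrow> bool" where
  "scaled_integral q \<longleftrightarrow> (\<forall>k. of_nat CARD('p) ^ k * coeff q k \<in> padic_ints)"

lemma scaled_integral_diff: "scaled_integral q \<Longrightarrow> scaled_integral r \<Longrightarrow> scaled_integral (q - r)"
  unfolding scaled_integral_def by (auto simp: right_diff_distrib)

lemma scaled_integral_smult: "c \<in> padic_ints \<Longrightarrow> scaled_integral q \<Longrightarrow> scaled_integral (smult c q)"
  unfolding scaled_integral_def by (auto simp: mult.left_commute)

lemma scaled_integral_sum: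
  "(\<And>i. i \<in> I \<Longrightarrow> scaled_integral (f i)) \<Longrightarrow> scaled_integral (\<Sum>i\<in>I. f i)"
  unfolding scaled_integral_def by (auto simp: coeff_sum sum_distrib_left)

text \<open>Substituting \<open>p T\<close> for \<open>T\<close> respects products:
  \<open>p ^ k\<close> is shared out as \<open>p ^ i * p ^ (k - i)\<close>.\<close>

lemma scaled_integral_mult:
  fixes q r :: "'p::prime_card padic poly"
  assumes "scaled_integral q" "scaled_integral r"
  shows "scaled_integral (q * r)"
  unfolding scaled_integral_def
proof
  fix k
  let ?P = "of_nat CARD('p) :: 'p padic"
  have "?P ^ k * coeff (q * r) k = (\<Sum>i\<le>k. (?P ^ i * coeff q i) * (?P ^ (k - i) * coeff r (k - i)))"
    unfolding coeff_mult sum_distrib_left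
  proof (intro sum.cong refl)
    fix i assume "i \<in> {..k}"
    then have "?P ^ k = ?P ^ i * ?P ^ (k - i)" by (simp add: power_add[symmetric])
    then show "?P ^ k * (coeff q i * coeff r (k - i)) = (?P ^ i * coeff q i) * (?P ^ (k - i) * coeff r (k - i))"
      by (simp add: mult_ac)
  qed
  also have "\<dots> \<in> padic_ints"
    using assms unfolding scaled_integral_def by blast
  finally show "?P ^ k * coeff (q * r) k \<in> padic_ints" .
qed

lemma scaled_integral_power:
  assumes "scaled_integral q"
  shows "scaled_integral (q ^ n)"
proof (induction n)
  case 0
  show ?case by (auto simp: scaled_integral_def)
next
  case (Suc n)
  then show ?case using assms by (simp add: scaled_integral_mult)
qed

text \<open>With \<open>w = p^2 t\<close>, the power \<open>w ^ k\<close> supplies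
  \<open>p ^ k\<close> twice: one copy makes the coefficient integral, the other is divisible by
  \<open>p ^ s\<close> as soon as \<open>k \<ge> s\<close>.\<close>

lemma poly_scaled_integral_cong_0:
  fixes q :: "'p::prime_card padic poly"
  assumes "scaled_integral q" "\<And>k. k < s \<Longrightarrow> coeff q k = 0" "padic_cong 2 w 0"
  shows "padic_cong s (poly q w) 0"
proof -
  let ?P = "of_nat CARD('p) :: 'p padic"
  obtain t where t: "t \<in> padic_ints" "w = ?P ^ 2 * t"
    using assms(3) by (auto simp: padic_cong_iff)
  have "padic_cong s (coeff q k * w ^ k) 0" for k
  proof (cases "k < s")
    case False
    then have "?P ^ k = ?P ^ s * ?P ^ (k - s)" by (simp add: power_add[symmetric])
    then have "coeff q k * w ^ k - 0 = ?P ^ s * (?P ^ (k - s) * (?P ^ k * coeff q k) * t ^ k)"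
      by (simp add: t(2) power_mult_distrib power_mult[symmetric] mult_2_right power_add mult_ac)
    moreover have "?P ^ k * coeff q k \<in> padic_ints"
      using assms(1) by (simp add: scaled_integral_def)
    ultimately show ?thesis
      using t(1) by (intro padic_congI[of _ _ _ "?P ^ (k - s) * (?P ^ k * coeff q k) * t ^ k"]) blast+
  qed (simp add: assms(2))
  then have "padic_cong s (\<Sum>k\<le>degree q. coeff q k * w ^ k) (\<Sum>k\<le>degree q. 0)"
    by (intro padic_cong_sum)
  then show ?thesis by (simp add: poly_altdef)
qed

lemma scaled_integral_trunc_log:
  "scaled_integral (smult (1 / of_nat CARD('p)) (trunc_log s) :: 'p::prime_card padic poly)"
  unfolding scaled_integral_def
proof
  fix k
  let ?P = "of_nat CARD('p) :: 'p padic"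
  show "?P ^ k * coeff (smult (1 / ?P) (trunc_log s)) k \<in> padic_ints"
  proof (cases k)
    case (Suc i)
    have "?P ^ k * coeff (smult (1 / ?P) (trunc_log s)) k =
        (if k < s then (- 1) ^ (k + 1) else 0) * (?P ^ i / of_nat (Suc i))"
      by (simp add: Suc coeff_trunc_log del: of_nat_Suc)
    also have "\<dots> \<in> padic_ints"
      using prime_power_div_in_padic_ints[of i] by (intro padic_ints_mult) (auto simp del: of_nat_Suc)
    finally show ?thesis .
  qed (simp add: coeff_trunc_log)
qed

text \<open>For \<open>L = trunc_log s\<close>, \<open>L^(m+1) / p = p^m (L / p)^(m+1)\<close>, and
  the gained \<open>p ^ m\<close> absorbs the denominator \<open>(m + 1)!\<close>.\<close>

lemma scaled_integral_trunc_exp_log: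
  "scaled_integral (smult (1 / of_nat CARD('p)) (trunc_exp_log s j) :: 'p::prime_card padic poly)"
proof -
  let ?P = "of_nat CARD('p) :: 'p padic"
  have "smult (1 / ?P) (trunc_exp_log s j) = (\<Sum>m<s - 1.
      smult (of_nat j ^ m * (?P ^ m / fact (Suc m))) (smult (1 / ?P) (trunc_log s) ^ Suc m))"
    unfolding trunc_exp_log_def smult_sum2 smult_power smult_smult
    by (intro sum.cong refl) (simp add: power_divide mult_ac del: fact_Suc)
  also have "scaled_integral \<dots>"
    using prime_power_div_fact_in_padic_ints[where 'p = 'p]
    by (intro scaled_integral_sum scaled_integral_smult scaled_integral_power scaled_integral_trunc_log
        padic_ints_mult) (auto simp del: fact_Suc)
  finally show ?thesis .
qed

text \<open>The denominator \<open>j\<close>, possibly divisible by \<open>p\<close>, disappears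
  through \<open>binom(j, i+1) / j = binom(j-1, i) / (i+1)\<close>; then \<open>p ^ i\<close>
  absorbs \<open>i + 1\<close>.\<close>

lemma scaled_integral_binomial_quotient:
  assumes "j > 0"
  shows "scaled_integral (smult (1 / of_nat CARD('p)) (binomial_quotient j) :: 'p::prime_card padic poly)"
  unfolding scaled_integral_def
proof
  fix k
  let ?P = "of_nat CARD('p) :: 'p padic"
  have c: "coeff ([:1, 1:] ^ j) k = (of_nat (j choose k) :: 'p padic)"
  proof (cases "k \<le> j")
    case True
    then show ?thesis by (simp add: coeff_linear_poly_power)
  next
    case False
    then have "degree ([:1, 1:] ^ j :: 'p padic poly) < k"
      using degree_power_le[of "[:1, 1:] :: 'p padic poly" j] by simp
    then show ?thesis using False by (simp add: coeff_eq_0)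
  qed
  show "?P ^ k * coeff (smult (1 / ?P) (binomial_quotient j)) k \<in> padic_ints"
  proof (cases k)
    case 0
    then show ?thesis using c by (simp add: binomial_quotient_def)
  next
    case (Suc i)
    obtain j' where j': "j = Suc j'" using assms by (cases j) auto
    have "of_nat (Suc i * (Suc j' choose Suc i)) = (of_nat (Suc j' * (j' choose i)) :: 'p padic)"
      by (simp only: Suc_times_binomial)
    then have "of_nat (Suc i) * of_nat (j choose k) = of_nat j * (of_nat (j' choose i) :: 'p padic)"
      by (simp only: of_nat_mult Suc j')
    then have "?P ^ k * coeff (smult (1 / ?P) (binomial_quotient j)) k =
        of_nat (j' choose i) * (?P ^ i / of_nat (Suc i))"
      using c assms by (simp add: binomial_quotient_def Suc field_simps del: of_nat_Suc binomial_Suc_Suc)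
    also have "\<dots> \<in> padic_ints"
      using prime_power_div_in_padic_ints[of i] by (intro padic_ints_mult) (auto simp del: of_nat_Suc)
    finally show ?thesis .
  qed
qed

lemma padic_cong_binomial_exp_log:
  fixes w :: "'p::prime_card padic"
  assumes "j > 0" "padic_cong 2 w 0"
  shows "padic_cong s (((1 + w) ^ j - 1) / (of_nat CARD('p) * of_nat j))
    (\<Sum>m<s - 1. of_nat j ^ m * (poly (trunc_log s) w ^ Suc m / of_nat CARD('p)) / fact (Suc m))"
proof -
  let ?P = "of_nat CARD('p) :: 'p padic"
  let ?D = "smult (1 / ?P) (binomial_quotient j) - smult (1 / ?P) (trunc_exp_log s j)"
  have "padic_cong s (poly ?D w) 0"
  proof (rule poly_scaled_integral_cong_0[OF _ _ assms(2)])
    show "scaled_integral ?D"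
      by (intro scaled_integral_diff scaled_integral_binomial_quotient assms scaled_integral_trunc_exp_log)
    show "coeff ?D k = 0" if "k < s" for k
      using coeff_trunc_exp_log[OF assms(1) that, where 'a = "'p padic"] by simp
  qed
  moreover have "poly ?D w = ((1 + w) ^ j - 1) / (?P * of_nat j) -
      (\<Sum>m<s - 1. of_nat j ^ m * (poly (trunc_log s) w ^ Suc m / ?P) / fact (Suc m))"
    by (simp add: binomial_quotient_def trunc_exp_log_def poly_sum sum_divide_distrib mult_ac del: fact_Suc power_Suc)
  ultimately show ?thesis by (simp add: padic_cong_def)
qed

section \<open>The two sums\<close>

lemma sum_coprime_prime_blocks:
  fixes f :: "nat \<Rightarrow> 'a::comm_monoid_add"
  assumes "prime p"
  shows "(\<Sum>j\<in>{j\<in>{1..p * n}. coprime j p}. f j) = (\<Sum>l<n. \<Sum>k=1..p - 1. f (k + p * l))"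
proof -
  have p0: "p > 1" using assms by (rule prime_gt_1_nat)
  have co: "coprime j p \<longleftrightarrow> j mod p \<noteq> 0" for j
    using assms by (metis coprime_commute dvd_eq_mod_eq_0 prime_imp_coprime coprime_absorb_left not_prime_unit)
  have "(\<Sum>l<n. \<Sum>k=1..p - 1. f (k + p * l)) = (\<Sum>(l, k)\<in>{..<n} \<times> {1..p - 1}. f (k + p * l))"
    by (rule sum.cartesian_product)
  also have "\<dots> = (\<Sum>j\<in>{j\<in>{1..p * n}. coprime j p}. f j)"
  proof (rule sum.reindex_bij_witness[of _ "\<lambda>j. (j div p, j mod p)" "\<lambda>(l, k). k + p * l"])
    fix a assume "a \<in> {..<n} \<times> {1..p - 1}"
    then obtain l k where a: "a = (l, k)" "l < n" "1 \<le> k" "k < p"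
      using p0 by (cases a) auto
    then have "p * Suc l \<le> p * n" by (intro mult_le_mono2) simp
    then show "(case a of (l, k) \<Rightarrow> k + p * l) \<in> {j\<in>{1..p * n}. coprime j p}"
      using a by (simp add: co)
    show "(\<lambda>j. (j div p, j mod p)) (case a of (l, k) \<Rightarrow> k + p * l) = a"
      using a by simp
  next
    fix j assume j: "j \<in> {j\<in>{1..p * n}. coprime j p}"
    then have "j mod p \<noteq> 0" by (simp add: co)
    \<comment> \<open>The upper endpoint \<open>p * n\<close> is itself a multiple of
      \<open>p\<close>; excluding it keeps the quotient below \<open>n\<close>.\<close>
    moreover have "j \<noteq> p * n" using calculation by auto
    then have "j div p < n" using j p0 by (simp add: less_mult_imp_div_less mult.commute)
    moreover have "j mod p < p" using p0 by simp
    ultimately show "(j div p, j mod p) \<in> {..<n} \<times> {1..p - 1}"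
      using p0 by (simp, linarith)
  qed auto
  finally show ?thesis by simp
qed

text \<open>A finite geometric series with ratio \<open>q = - p l / k\<close>. Its error is exactly
  \<open>q ^ s / (k + p l)\<close>, which is \<open>p ^ s\<close> times an integral element because
  \<open>k\<close> and \<open>k + p l\<close> are units.\<close>

lemma padic_cong_reciprocal_expansion:
  fixes l :: nat
  assumes "coprime k CARD('p)"
  shows "padic_cong s (1 / of_nat (k + CARD('p) * l))
    (\<Sum>m<s. (- 1) ^ m * of_nat CARD('p) ^ m * of_nat l ^ m / of_nat k ^ (m + 1) :: 'p::prime_card padic)"
proof -
  let ?P = "of_nat CARD('p) :: 'p padic" and ?j = "k + CARD('p) * l"
  define q where "q = - (?P * of_nat l / of_nat k)"
  have co: "coprime ?j CARD('p)" 
    using assms gcd_add_mult[of "CARD('p)" l k]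
    by (simp add: coprime_iff_gcd_eq_1 gcd.commute[of _ "CARD('p)"] add.commute mult.commute)
  have k0: "k > 0" using assms prime_gt_1_nat[OF prime_card[where 'a = 'p]] by (auto intro: Nat.gr0I)
  have j: "(of_nat ?j :: 'p padic) = of_nat k * (1 - q)" using k0 by (simp add: q_def field_simps)
  have j0: "(of_nat ?j :: 'p padic) \<noteq> 0" using k0 by (simp del: of_nat_add)
  have qm: "q ^ m = (- 1) ^ m * ?P ^ m * of_nat l ^ m / of_nat k ^ m" for m
    unfolding q_def by (subst power_minus) (simp add: power_mult_distrib power_divide)
  have "(\<Sum>m<s. (- 1) ^ m * ?P ^ m * of_nat l ^ m / of_nat k ^ (m + 1)) = (\<Sum>m<s. q ^ m) / of_nat k"
    unfolding sum_divide_distrib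
    by (intro sum.cong refl) (simp add: qm)
  also have "\<dots> = (1 - q ^ s) / of_nat ?j"
    using j0 k0 unfolding j one_diff_power_eq by (simp add: divide_simps)
  finally have "1 / of_nat ?j - (\<Sum>m<s. (- 1) ^ m * ?P ^ m * of_nat l ^ m / of_nat k ^ (m + 1)) =
      q ^ s * (1 / of_nat ?j)"
    by (simp add: diff_divide_distrib del: of_nat_add)
  also have "q ^ s = ?P ^ s * (- of_nat l * (1 / of_nat k)) ^ s"
    unfolding power_mult_distrib[symmetric] by (simp add: q_def)
  finally have "1 / of_nat ?j - (\<Sum>m<s. (- 1) ^ m * ?P ^ m * of_nat l ^ m / of_nat k ^ (m + 1)) =
      ?P ^ s * ((- of_nat l * (1 / of_nat k)) ^ s * (1 / of_nat ?j))"
    by (simp only: mult.assoc)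
  then show ?thesis
    by (rule padic_congI)
      (intro padic_ints_mult padic_ints_power padic_ints_minus padic_ints_of_nat
        inverse_of_nat_in_padic_ints assms co)
qed

text \<open>The exponent splits as \<open>p (k + p l) = p k + p^2 l\<close>, so for each
  \<open>m\<close> the double sum factors into a sum over \<open>k\<close> and a power sum over
  \<open>l\<close>.\<close>

lemma padic_cong_sum_coprime:
  fixes y :: "'p::prime_card padic"
  assumes y: "y \<in> padic_ints"
  defines "p \<equiv> CARD('p)"
  shows "padic_cong s (\<Sum>j\<in>{j\<in>{1..p * n}. coprime j p}. y ^ (p * j) / of_nat j)
    (\<Sum>m<s. ((- 1) ^ m * of_nat p ^ m * (\<Sum>k=1..p - 1. y ^ (p * k) / of_nat k ^ (m + 1))) *
       (\<Sum>l<n. of_nat l ^ m * (y ^ p\<^sup>2) ^ l))"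
proof -
  let ?e = "\<lambda>l k m. (- 1) ^ m * of_nat p ^ m * of_nat l ^ m / of_nat k ^ (m + 1) :: 'p padic"
  have pp: "prime p" unfolding p_def by (rule prime_card)
  have "padic_cong s (y ^ (p * (k + p * l)) / of_nat (k + p * l))
      (y ^ (p * (k + p * l)) * (\<Sum>m<s. ?e l k m))" if "k \<in> {1..p - 1}" for k l
  proof -
    have "\<not> p dvd k" using that prime_gt_1_nat[OF pp] by (auto dest: dvd_imp_le)
    then have "coprime k p" using pp by (meson coprime_commute prime_imp_coprime)
    then have "padic_cong s (1 / of_nat (k + p * l)) (\<Sum>m<s. ?e l k m)"
      unfolding p_def by (rule padic_cong_reciprocal_expansion)
    from padic_cong_mult_left[OF this, of "y ^ (p * (k + p * l))"] show ?thesis using y by auto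
  qed
  then have "padic_cong s (\<Sum>l<n. \<Sum>k=1..p - 1. y ^ (p * (k + p * l)) / of_nat (k + p * l))
      (\<Sum>l<n. \<Sum>k=1..p - 1. y ^ (p * (k + p * l)) * (\<Sum>m<s. ?e l k m))"
    by (intro padic_cong_sum)
  also have "(\<Sum>l<n. \<Sum>k=1..p - 1. y ^ (p * (k + p * l)) * (\<Sum>m<s. ?e l k m)) =
      (\<Sum>l<n. \<Sum>m<s. \<Sum>k=1..p - 1. y ^ (p * (k + p * l)) * ?e l k m)"
    unfolding sum_distrib_left by (intro sum.cong refl sum.swap)
  also have "\<dots> = (\<Sum>m<s. \<Sum>l<n. \<Sum>k=1..p - 1. y ^ (p * (k + p * l)) * ?e l k m)"
    by (rule sum.swap)
  also have "\<dots> = (\<Sum>m<s. ((- 1) ^ m * of_nat p ^ m * (\<Sum>k=1..p - 1. y ^ (p * k) / of_nat k ^ (m + 1))) *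
       (\<Sum>l<n. of_nat l ^ m * (y ^ p\<^sup>2) ^ l))"
  proof (rule sum.cong[OF refl])
    fix m
    have "(\<Sum>k=1..p - 1. y ^ (p * (k + p * l)) * ?e l k m) =
        (- 1) ^ m * of_nat p ^ m * (\<Sum>k=1..p - 1. y ^ (p * k) / of_nat k ^ (m + 1)) *
          (of_nat l ^ m * (y ^ p\<^sup>2) ^ l)" for l
      unfolding sum_distrib_left sum_distrib_right
      by (intro sum.cong refl)
        (simp add: distrib_left power_add power_mult[symmetric] power2_eq_square mult_ac)
    then show "(\<Sum>l<n. \<Sum>k=1..p - 1. y ^ (p * (k + p * l)) * ?e l k m) =
        ((- 1) ^ m * of_nat p ^ m * (\<Sum>k=1..p - 1. y ^ (p * k) / of_nat k ^ (m + 1))) *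
          (\<Sum>l<n. of_nat l ^ m * (y ^ p\<^sup>2) ^ l)"
      unfolding sum_distrib_left by (simp only:)
  qed
  finally show ?thesis unfolding sum_coprime_prime_blocks[OF pp] .
qed

text \<open>The binomial-exponential congruence is applied to each \<open>j\<close>, after pulling
  out \<open>y ^ (p * j)\<close>. Integrality of \<open>z\<close> is what allows the exact value to
  be exchanged for \<open>z\<close> inside powers.\<close>

lemma padic_cong_sum_power_quotient:
  fixes y z :: "'p::prime_card padic"
  assumes y: "pval y = 0"
    and z: "padic_cong s z (1 / of_nat CARD('p) ^ 2 * poly (trunc_log s) (y ^ (CARD('p) * (CARD('p) - 1)) - 1))"
  defines "p \<equiv> CARD('p)"
  shows "z \<in> padic_ints"
    and "padic_cong s (\<Sum>j=1..n. (y ^ (p\<^sup>2 * j) - y ^ (p * j)) / (of_nat p * of_nat j))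
      (\<Sum>m<s - 1. of_nat p ^ (2 * m + 1) * (z ^ (m + 1) / fact (m + 1)) *
         (\<Sum>j=1..n. of_nat j ^ m * (y ^ p) ^ j))"
proof -
  let ?P = "of_nat p :: 'p padic"
  define w where "w = y ^ (p * (p - 1)) - 1"
  define L where "L = poly (trunc_log s) w"
  define z' where "z' = 1 / ?P ^ 2 * L"
  have p1: "p > 1" unfolding p_def by (rule prime_gt_1_nat[OF prime_card])
  have P0: "?P \<noteq> 0" using p1 by simp
  have yi: "y \<in> padic_ints" using y by (simp add: padic_ints_def)
  have "padic_cong 2 ((y ^ (p - 1)) ^ p) 1"
    unfolding p_def by (rule padic_cong_prime_power_1[OF padic_fermat[OF y]])
  then have w: "padic_cong 2 w 0"
    by (simp add: w_def padic_cong_def power_mult[symmetric] mult.commute)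
  then obtain t where t: "t \<in> padic_ints" "w = ?P ^ 2 * t"
    by (auto simp: padic_cong_iff p_def)
  \<comment> \<open>Since \<open>w = p^2 t\<close>, term \<open>k\<close> of the logarithm over
    \<open>p^2\<close> carries \<open>p^(2k-2) / k\<close>; one \<open>p^(k-1)\<close> already
    cancels the denominator \<open>k\<close>.\<close>
  have "z' = (\<Sum>k\<in>{1..<s}. (- 1) ^ (k + 1) * (?P ^ (k - 1) * (?P ^ (k - 1) / of_nat (Suc (k - 1))) * t ^ k))"
    unfolding z'_def L_def trunc_log_def poly_sum sum_distrib_left
  proof (intro sum.cong refl)
    fix k assume "k \<in> {1..<s}"
    then obtain i where "k = Suc i" by (cases k) auto
    then show "1 / ?P ^ 2 * poly (monom ((- 1) ^ (k + 1) / of_nat k) k) w =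
        (- 1) ^ (k + 1) * (?P ^ (k - 1) * (?P ^ (k - 1) / of_nat (Suc (k - 1))) * t ^ k)"
      using P0 by (simp add: t(2) poly_monom power_mult_distrib power2_eq_square field_simps del: of_nat_Suc)
  qed
  also have "\<dots> \<in> padic_ints"
    using t(1) prime_power_div_in_padic_ints[where 'p = 'p] unfolding p_def
    by (intro padic_ints_sum padic_ints_mult padic_ints_power padic_ints_minus padic_ints_1 padic_ints_of_nat)
  finally have z'_int: "z' \<in> padic_ints" .
  have zz': "padic_cong s z z'" using z by (simp add: z'_def L_def w_def p_def)
  show z_int: "z \<in> padic_ints" by (rule padic_cong_ints[OF zz' z'_int])
  \<comment> \<open>Powers of \<open>z'\<close> and \<open>z\<close> are congruent, but the division
    by \<open>(m + 1)!\<close> could spoil this; together with \<open>p ^ (2 * m + 1)\<close> the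
    factor is integral.\<close>
  have c_int: "?P ^ (2 * m + 1) / fact (m + 1) \<in> padic_ints" for m
  proof -
    have "?P ^ (2 * m + 1) / fact (m + 1) = ?P ^ Suc m * (?P ^ m / fact (Suc m))"
      by (simp add: mult_2_right power_add mult_ac)
    then show ?thesis using prime_power_div_fact_in_padic_ints[where 'p = 'p, of m] unfolding p_def
      by (metis padic_ints_mult padic_ints_of_nat padic_ints_power)
  qed
  have cc: "padic_cong s (?P ^ (2 * m + 1) * (z' ^ (m + 1) / fact (m + 1)))
      (?P ^ (2 * m + 1) * (z ^ (m + 1) / fact (m + 1)))" for m
    using padic_cong_mult_left[OF padic_cong_power[OF padic_cong_sym[OF zz'] z_int, of "m + 1"] c_int[of m]]
    by (simp add: mult_ac)
  have term_cong: "padic_cong s ((y ^ (p\<^sup>2 * j) - y ^ (p * j)) / (?P * of_nat j))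
      (\<Sum>m<s - 1. ?P ^ (2 * m + 1) * (z ^ (m + 1) / fact (m + 1)) * (of_nat j ^ m * (y ^ p) ^ j))"
    if "j \<in> {1..n}" for j
  proof -
    have "p\<^sup>2 * j = p * j + p * (p - 1) * j"
      using p1 by (cases p) (simp_all add: power2_eq_square algebra_simps)
    then have "y ^ (p\<^sup>2 * j) = (y ^ p) ^ j * (1 + w) ^ j"
      by (simp add: w_def power_add power_mult)
    then have "(y ^ (p\<^sup>2 * j) - y ^ (p * j)) / (?P * of_nat j) =
        (y ^ p) ^ j * (((1 + w) ^ j - 1) / (?P * of_nat j))"
      by (simp add: power_mult[of y p j] right_diff_distrib)
    also have "padic_cong s \<dots> ((y ^ p) ^ j * (\<Sum>m<s - 1. of_nat j ^ m * (L ^ Suc m / ?P) / fact (Suc m)))"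
      using that yi unfolding L_def p_def
      by (intro padic_cong_mult_left padic_cong_binomial_exp_log w padic_ints_power) auto
    also have "(y ^ p) ^ j * (\<Sum>m<s - 1. of_nat j ^ m * (L ^ Suc m / ?P) / fact (Suc m)) =
       (\<Sum>m<s - 1. (of_nat j ^ m * (y ^ p) ^ j) * (?P ^ (2 * m + 1) * (z' ^ (m + 1) / fact (m + 1))))"
    proof -
      have "L ^ Suc m / ?P = ?P ^ (2 * m + 1) * z' ^ (m + 1)" for m
      proof -
        have "L = ?P ^ 2 * z'" using P0 by (simp add: z'_def)
        then have "L ^ Suc m = ?P ^ (2 * Suc m) * z' ^ Suc m"
          by (simp only: power_mult_distrib power_mult)
        then show ?thesis using P0 by simp
      qed
      then show ?thesis by (simp add: sum_distrib_left mult_ac del: fact_Suc power_Suc)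
    qed
    also have "padic_cong s \<dots>
       (\<Sum>m<s - 1. (of_nat j ^ m * (y ^ p) ^ j) * (?P ^ (2 * m + 1) * (z ^ (m + 1) / fact (m + 1))))"
      using yi by (intro padic_cong_sum padic_cong_mult_left cc) blast
    finally show ?thesis by (simp only: mult_ac)
  qed
  have "padic_cong s (\<Sum>j=1..n. (y ^ (p\<^sup>2 * j) - y ^ (p * j)) / (?P * of_nat j))
     (\<Sum>j=1..n. \<Sum>m<s - 1. ?P ^ (2 * m + 1) * (z ^ (m + 1) / fact (m + 1)) * (of_nat j ^ m * (y ^ p) ^ j))"
    by (intro padic_cong_sum term_cong)
  also have "(\<Sum>j=1..n. \<Sum>m<s - 1. ?P ^ (2 * m + 1) * (z ^ (m + 1) / fact (m + 1)) * (of_nat j ^ m * (y ^ p) ^ j)) =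
     (\<Sum>m<s - 1. ?P ^ (2 * m + 1) * (z ^ (m + 1) / fact (m + 1)) * (\<Sum>j=1..n. of_nat j ^ m * (y ^ p) ^ j))"
    unfolding sum_distrib_left by (rule sum.swap)
  finally show "padic_cong s (\<Sum>j=1..n. (y ^ (p\<^sup>2 * j) - y ^ (p * j)) / (?P * of_nat j))
     (\<Sum>m<s - 1. ?P ^ (2 * m + 1) * (z ^ (m + 1) / fact (m + 1)) * (\<Sum>j=1..n. of_nat j ^ m * (y ^ p) ^ j))" .
qed

text \<open>The \<open>A i\<close> and \<open>N i\<close> are given only modulo
  \<open>p ^ s\<close>; this passes from exact coefficients to such representatives.\<close>

lemma padic_cong_poly_coeffs:
  assumes "\<And>i. i < s \<Longrightarrow> padic_cong s (A i) (B i)" "s > 0" "x \<in> padic_ints"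
  shows "padic_cong s (B 0 - x * (\<Sum>i<s. B i * of_nat n ^ i)) (A 0 - x * (\<Sum>i<s. A i * of_nat n ^ i))"
proof -
  have "padic_cong s (B i * of_nat n ^ i) (A i * of_nat n ^ i)" if "i < s" for i
    using padic_cong_mult_left[OF padic_cong_sym[OF assms(1)[OF that]], of "of_nat n ^ i"]
    by (simp add: mult.commute padic_ints_power)
  then have "padic_cong s (\<Sum>i<s. B i * of_nat n ^ i) (\<Sum>i<s. A i * of_nat n ^ i)"
    by (intro padic_cong_sum) simp
  then show ?thesis
    by (intro padic_cong_diff padic_cong_mult_left padic_cong_sym[OF assms(1)] assms)
qed

theorem theorem2:
  fixes p s :: nat
    and y z :: "'p::prime_card padic"
    and A N :: "nat \<Rightarrow> 'p padic"
  assumes p_eq: "p = CARD('p)"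
    and p_gt_2: "p > 2"
    and s_ge_1: "s \<ge> 1"
    and y_int: "y \<in> padic_ints"
    and y_val: "pval y = 0"
    and y_ne_1: "y \<noteq> 1"
    and z: "padic_cong s z (1 / of_nat p ^ 2 *
                (\<Sum>j\<in>{1..<s}. (- 1) ^ (j + 1) / of_nat j * (y ^ (p * (p - 1)) - 1) ^ j))"
    and A: "\<And>i. i \<le> s - 1 \<Longrightarrow>
              padic_cong s (A i) (\<Sum>m\<in>{i..<s}. (- 1) ^ m * of_nat p ^ m * of_nat (m choose i) *
                  (\<Sum>k=1..p - 1. y ^ (p * k) / of_nat k ^ (m + 1)) *
                  (\<Sum>k=0..m - i. fact k * of_nat (Stirling (m - i) k) *
                     (y ^ (p ^ 2 * k) / (1 - y ^ (p ^ 2)) ^ (k + 1))))"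
    and N: "\<And>i. i \<le> s - 1 \<Longrightarrow>
              padic_cong s (N i) (- (of_nat p ^ (2 * i + 1)) * (z ^ (i + 1) / fact (i + 1)) +
                (\<Sum>m\<in>{i..<s - 1}. of_nat p ^ (2 * m + 1) * (z ^ (m + 1) / fact (m + 1)) *
                  of_nat (m choose i) *
                  (\<Sum>k=0..m - i. fact k * of_nat (Stirling (m - i) k) *
                     (y ^ (p * k) / (1 - y ^ p) ^ (k + 1)))))"
  shows "\<forall>n\<ge>1::nat.
           padic_cong s (\<Sum>j\<in>{j\<in>{1..p * n}. coprime j p}. y ^ (p * j) / of_nat j)
              (A 0 - y ^ (p ^ 2 * n) * (\<Sum>i=0..s - 1. A i * of_nat n ^ i)) \<and>
           padic_cong s (\<Sum>j=1..n. (y ^ (p ^ 2 * j) - y ^ (p * j)) / (of_nat p * of_nat j))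
              (N 0 - y ^ (p * n) * (\<Sum>i=0..s - 1. N i * of_nat n ^ i))"
proof (intro allI impI)
  fix n :: nat
  assume "n \<ge> 1"
  let ?P = "of_nat p :: 'p padic"
  \<comment> \<open>The closed forms are used at \<open>y ^ p\<close> and
    \<open>y ^ p\<^sup>2\<close>, which must differ from 1; triviality of \<open>p\<close>-th roots
    of unity is applied twice.\<close>
  have yp: "y ^ p \<noteq> 1"
    using padic_prime_root_of_unity[of y] p_gt_2 y_int y_ne_1 unfolding p_eq by blast
  have "(y ^ p) ^ p \<noteq> 1"
    using padic_prime_root_of_unity[of "y ^ p"] p_gt_2 padic_ints_power[OF y_int, of p] yp
    unfolding p_eq by blast
  then have yp2: "y ^ p\<^sup>2 \<noteq> 1"
    by (simp add: power2_eq_square power_mult)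
  have idx: "{0..s - 1} = {..<s}" using s_ge_1 by auto

  define a where "a m = (- 1) ^ m * ?P ^ m * (\<Sum>k=1..p - 1. y ^ (p * k) / of_nat k ^ (m + 1))" for m
  define B where "B i = (\<Sum>m\<in>{i..<s}. a m * of_nat (m choose i) * geom_moment (y ^ p\<^sup>2) (m - i))" for i
  have AB: "padic_cong s (A i) (B i)" if "i < s" for i
  proof -
    have "B i = (\<Sum>m\<in>{i..<s}. (- 1) ^ m * ?P ^ m * of_nat (m choose i) *
        (\<Sum>k=1..p - 1. y ^ (p * k) / of_nat k ^ (m + 1)) *
        (\<Sum>k=0..m - i. fact k * of_nat (Stirling (m - i) k) *
           (y ^ (p ^ 2 * k) / (1 - y ^ (p ^ 2)) ^ (k + 1))))"
      unfolding B_def a_def geom_moment_def power_mult by (intro sum.cong refl) (simp only: mult_ac)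
    then show ?thesis using A[of i] that by simp
  qed
  have "padic_cong s (\<Sum>j\<in>{j\<in>{1..p * n}. coprime j p}. y ^ (p * j) / of_nat j)
      (\<Sum>m<s. a m * (\<Sum>l<n. of_nat l ^ m * (y ^ p\<^sup>2) ^ l))"
    unfolding a_def p_eq by (rule padic_cong_sum_coprime[OF y_int])
  also have "(\<Sum>m<s. a m * (\<Sum>l<n. of_nat l ^ m * (y ^ p\<^sup>2) ^ l)) =
      B 0 - (y ^ p\<^sup>2) ^ n * (\<Sum>i<s. B i * of_nat n ^ i)"
    unfolding B_def by (rule sum_moments_geometric[OF yp2])
  also have "padic_cong s \<dots> (A 0 - (y ^ p\<^sup>2) ^ n * (\<Sum>i<s. A i * of_nat n ^ i))"
    using AB s_ge_1 y_int by (intro padic_cong_poly_coeffs) auto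
  finally have part1: "padic_cong s (\<Sum>j\<in>{j\<in>{1..p * n}. coprime j p}. y ^ (p * j) / of_nat j)
      (A 0 - y ^ (p ^ 2 * n) * (\<Sum>i=0..s - 1. A i * of_nat n ^ i))"
    by (simp only: idx power_mult)

  have z': "padic_cong s z (1 / of_nat CARD('p) ^ 2 *
      poly (trunc_log s) (y ^ (CARD('p) * (CARD('p) - 1)) - 1))"
    using z by (simp add: p_eq trunc_log_def poly_sum poly_monom)
  have z_int: "z \<in> padic_ints"
    by (rule padic_cong_sum_power_quotient(1)[OF y_val z'])
  define c where "c m = ?P ^ (2 * m + 1) * (z ^ (m + 1) / fact (m + 1))" for m
  \<comment> \<open>\<open>D i\<close> comes from the power sums over \<open>l < n\<close>; the
    extra \<open>- c i\<close> in \<open>N i\<close> comes from the summand \<open>j = n\<close>,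
    which those sums miss.\<close>
  define D where "D i = (\<Sum>m\<in>{i..<s - 1}. c m * of_nat (m choose i) * geom_moment (y ^ p) (m - i))" for i
  have ND: "padic_cong s (N i) (D i - c i)" if "i < s" for i
  proof -
    have "D i - c i = - (?P ^ (2 * i + 1)) * (z ^ (i + 1) / fact (i + 1)) +
       (\<Sum>m\<in>{i..<s - 1}. ?P ^ (2 * m + 1) * (z ^ (m + 1) / fact (m + 1)) * of_nat (m choose i) *
          (\<Sum>k=0..m - i. fact k * of_nat (Stirling (m - i) k) *
             (y ^ (p * k) / (1 - y ^ p) ^ (k + 1))))"
      unfolding D_def c_def geom_moment_def power_mult by simp
    then show ?thesis using N[of i] that by simp
  qed
  \<comment> \<open>The \<open>N i\<close> run up to \<open>i = s - 1\<close> although only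
    \<open>m < s - 1\<close> occurs in the expansion. The surplus term is harmless:
    \<open>p^(2s-1) / s! = p^s * (p^(s-1) / s!)\<close>.\<close>
  have c_last: "padic_cong s (c (s - 1)) 0"
  proof (rule padic_congI)
    obtain r where r: "s = Suc r" using s_ge_1 by (cases s) auto
    show "c (s - 1) - 0 = of_nat CARD('p) ^ s * ((?P ^ (s - 1) / fact (Suc (s - 1))) * z ^ s)"
      by (simp add: c_def r p_eq mult_2_right power_add mult_ac del: fact_Suc)
    show "(?P ^ (s - 1) / fact (Suc (s - 1))) * z ^ s \<in> padic_ints"
      unfolding p_eq by (intro padic_ints_mult prime_power_div_fact_in_padic_ints padic_ints_power z_int)
  qed
  \<comment> \<open>Moving from \<open>l < n\<close> to \<open>1..n\<close> adds the summand at
    \<open>n\<close> and removes the one at 0, which is 1 for \<open>m = 0\<close> by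
    \<open>0 ^ 0 = 1\<close>.\<close>
  have split: "(\<Sum>j=1..n. of_nat j ^ m * (y ^ p) ^ j) =
      (\<Sum>l<n. of_nat l ^ m * (y ^ p) ^ l) + (y ^ p) ^ n * of_nat n ^ m - (if m = 0 then 1 else 0)" for m
  proof -
    have "(\<Sum>j<Suc n. of_nat j ^ m * (y ^ p) ^ j) =
        (if m = 0 then 1 else 0) + (\<Sum>j=1..n. of_nat j ^ m * (y ^ p) ^ j)"
      unfolding lessThan_Suc_atMost atMost_atLeast0 by (subst sum.atLeast_Suc_atMost) (auto simp: power_0_left)
    then show ?thesis by (simp add: algebra_simps)
  qed
  have "padic_cong s (\<Sum>j=1..n. (y ^ (p\<^sup>2 * j) - y ^ (p * j)) / (?P * of_nat j))
      (\<Sum>m<s - 1. c m * (\<Sum>j=1..n. of_nat j ^ m * (y ^ p) ^ j))"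
    unfolding c_def p_eq by (rule padic_cong_sum_power_quotient(2)[OF y_val z'])
  also have "(\<Sum>m<s - 1. c m * (\<Sum>j=1..n. of_nat j ^ m * (y ^ p) ^ j)) =
      (\<Sum>m<s - 1. c m * (\<Sum>l<n. of_nat l ^ m * (y ^ p) ^ l)) +
      (y ^ p) ^ n * (\<Sum>m<s - 1. c m * of_nat n ^ m) - (\<Sum>m<s - 1. c m * (if m = 0 then 1 else 0))"
    unfolding split right_diff_distrib distrib_left sum.distrib sum_subtractf sum_distrib_left
    by (simp only: mult_ac)
  also have "(\<Sum>m<s - 1. c m * (\<Sum>l<n. of_nat l ^ m * (y ^ p) ^ l)) =
      D 0 - (y ^ p) ^ n * (\<Sum>i<s - 1. D i * of_nat n ^ i)"
    unfolding D_def by (rule sum_moments_geometric[OF yp])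
  \<comment> \<open>Index \<open>s - 1\<close> is added to the sum over \<open>i\<close>, where
    \<open>D\<close> is an empty sum and only the \<open>c\<close> term must be corrected. For
    \<open>s = 1\<close> the sums over \<open>m\<close> are empty, so the \<open>c 0\<close>
    subtracted from \<open>D 0\<close> has to be added back.\<close>
  also have "D 0 - (y ^ p) ^ n * (\<Sum>i<s - 1. D i * of_nat n ^ i) +
      (y ^ p) ^ n * (\<Sum>m<s - 1. c m * of_nat n ^ m) - (\<Sum>m<s - 1. c m * (if m = 0 then 1 else 0)) =
      (D 0 - c 0 - (y ^ p) ^ n * (\<Sum>i<s. (D i - c i) * of_nat n ^ i)) +
      ((if s = 1 then c (s - 1) else 0) - (y ^ p) ^ n * of_nat n ^ (s - 1) * c (s - 1))"
  proof -
    obtain r where r: "s = Suc r" using s_ge_1 by (cases s) auto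
    have "D r = 0" by (simp add: D_def r)
    moreover have "(\<Sum>m<r. c m * (if m = 0 then 1 else 0)) = (if r = 0 then 0 else c 0)"
      by (simp add: if_distrib[of "\<lambda>x. _ * x"] cong: if_cong)
    ultimately show ?thesis
      by (simp add: r left_diff_distrib sum_subtractf algebra_simps)
  qed
  also have "padic_cong s \<dots> ((N 0 - (y ^ p) ^ n * (\<Sum>i<s. N i * of_nat n ^ i)) + (0 - 0))"
  proof (rule padic_cong_add)
    show "padic_cong s (D 0 - c 0 - (y ^ p) ^ n * (\<Sum>i<s. (D i - c i) * of_nat n ^ i))
        (N 0 - (y ^ p) ^ n * (\<Sum>i<s. N i * of_nat n ^ i))"
      by (rule padic_cong_poly_coeffs[of s N "\<lambda>i. D i - c i"]) (use ND s_ge_1 y_int in auto)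
    have "padic_cong s (if s = 1 then c (s - 1) else 0) 0" using c_last by auto
    moreover have "padic_cong s ((y ^ p) ^ n * of_nat n ^ (s - 1) * c (s - 1)) 0"
      using padic_cong_mult_left[OF c_last, of "(y ^ p) ^ n * of_nat n ^ (s - 1)"] y_int by auto
    ultimately show "padic_cong s ((if s = 1 then c (s - 1) else 0) -
        (y ^ p) ^ n * of_nat n ^ (s - 1) * c (s - 1)) (0 - 0)"
      by (rule padic_cong_diff)
  qed
  finally have "padic_cong s (\<Sum>j=1..n. (y ^ (p ^ 2 * j) - y ^ (p * j)) / (?P * of_nat j))
      (N 0 - y ^ (p * n) * (\<Sum>i=0..s - 1. N i * of_nat n ^ i))"
    by (simp only: idx power_mult diff_self add_0_right)
  with part1 show "padic_cong s (\<Sum>j\<in>{j\<in>{1..p * n}. coprime j p}. y ^ (p * j) / of_nat j)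
              (A 0 - y ^ (p ^ 2 * n) * (\<Sum>i=0..s - 1. A i * of_nat n ^ i)) \<and>
           padic_cong s (\<Sum>j=1..n. (y ^ (p ^ 2 * j) - y ^ (p * j)) / (of_nat p * of_nat j))
              (N 0 - y ^ (p * n) * (\<Sum>i=0..s - 1. N i * of_nat n ^ i))"
    by (rule conjI)
qed

end
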